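(* Assume that $\{\omega_x\}_{x\in\mathbb{Z}}$ are i.i.d. under $P$ with $P(\omega_0\in[c,1-c])=1$ for some $c>0$, and that $E_P[\rho_0]<1$, where $\rho_x=\frac{1-\omega_x}{\omega_x}$. Then for any real $A<B$ and any $\gamma<\infty$, $$\lim_{n\to\infty}\ \max_{y\in(An,Bn],\ i\le n^\gamma}\left|\frac{X^{y,i}_n-y}{n}-\mathrm{v}_P\right|=0,\qquad \mathbb{P}\text{-a.s.},$$ where $\mathrm{v}_P=\frac{1-E_P[\rho_0]}{1+E_P[\rho_0]}$.
   Context: An environment is an element $\omega=\{\omega_x\}_{x\in\mathbb{Z}}$ of $\Omega=[0,1]^{\mathbb{Z}}$. Given $\omega$, under the quenched law $P_\omega$, $\{X^{x,i}_\cdot\}_{x\in\mathbb{Z},\,i\ge 1}$ is an independent collection of nearest-neighbor Markov chains on $\mathbb{Z}$ with $P_\omega(X^{x,i}_0=x)=1$, and from a site $y$ each chain steps to $y+1$ with probability $\omega_y$ and to $y-1$ with probability $1-\omega_y$. $P$ is a probability measure on $\Omega$ with expectation $E_P$. The averaged law is $\mathbb{P}(\cdot)=\int_\Omega P_\omega(\cdot)\,P(d\omega)$. In the maximum, $y$ ranges over integers and $i$ over positive integers. *)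

theory Defs
  imports "HOL-Probability.Probability"
begin

section \<open>Environments\<close>

definition environments :: "(int \<Rightarrow> real) measure" where
  "environments = PiM UNIV (\<lambda>_. restrict_space borel {0..1})"

definition rho :: "(int \<Rightarrow> real) \<Rightarrow> int \<Rightarrow> real" where
  "rho \<omega> x = (1 - \<omega> x) / \<omega> x"

definition speed :: "(int \<Rightarrow> real) measure \<Rightarrow> real" where
  "speed P = (1 - (\<integral>\<omega>. rho \<omega> 0 \<partial>P)) / (1 + (\<integral>\<omega>. rho \<omega> 0 \<partial>P))"


section \<open>The chain in a fixed environment\<close>

definition step_law :: "(int \<Rightarrow> real) \<Rightarrow> int \<Rightarrow> int pmf" where
  "step_law \<omega> y = map_pmf (\<lambda>right. if right then y + 1 else y - 1) (bernoulli_pmf (\<omega> y))"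

text \<open>The law of the position at time \<open>n\<close> given the positions \<open>h 0, \<dots>, h (n - 1)\<close>.\<close>

definition walk_kernel :: "(int \<Rightarrow> real) \<Rightarrow> int \<Rightarrow> nat \<Rightarrow> (nat \<Rightarrow> int) \<Rightarrow> int measure" where
  "walk_kernel \<omega> x n h =
    measure_pmf (case n of 0 \<Rightarrow> return_pmf x | Suc k \<Rightarrow> step_law \<omega> (h k))"

abbreviation trajectories :: "(nat \<Rightarrow> int) measure" where
  "trajectories \<equiv> PiM UNIV (\<lambda>_. count_space UNIV)"

lemma sets_PiM_count_space_finite:
  assumes "finite J"
  shows "sets (PiM J (\<lambda>_. count_space (UNIV :: int set))) = Pow (J \<rightarrow>\<^sub>E UNIV)"
  using assms by (simp add: count_space_PiM_finite)

interpretation walk: Ionescu_Tulcea "walk_kernel \<omega> x" "\<lambda>_. count_space UNIV" for \<omega> x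
proof (rule Ionescu_Tulcea.intro)
  show "walk_kernel \<omega> x i \<in> PiM {0..<i} (\<lambda>_. count_space UNIV) \<rightarrow>\<^sub>M subprob_algebra (count_space UNIV)"
    for i
    by (simp add: count_space_PiM_finite walk_kernel_def space_subprob_algebra
          measure_pmf.subprob_space_axioms)
  show "prob_space (walk_kernel \<omega> x i h)" for i h
    unfolding walk_kernel_def by (rule measure_pmf.prob_space_axioms)
qed

text \<open>
  The law of the chain started at \<open>x\<close>, given by the Ionescu-Tulcea theorem applied to
  \<^const>\<open>walk_kernel\<close>. The lemma \<open>emeasure_walk_law\<close> below computes it on cylinders.
\<close>

definition walk_law :: "(int \<Rightarrow> real) \<Rightarrow> int \<Rightarrow> (nat \<Rightarrow> int) measure" where
  "walk_law \<omega> x = walk.PF.lim \<omega> x"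

lemma sets_walk_law: "sets (walk_law \<omega> x) = sets trajectories"
  by (simp add: walk_law_def)

lemma emeasure_walk_C:
  "emeasure (walk.C \<omega> x 0 n (\<lambda>_. undefined)) {restrict p {0..<n}} =
    (\<Prod>k<n. ennreal (pmf (case k of 0 \<Rightarrow> return_pmf x | Suc j \<Rightarrow> step_law \<omega> (p j)) (p k)))"
proof (induction n)
  case 0
  show ?case
    by (simp add: count_space_PiM_finite restrict_def)
next
  case (Suc n)
  let ?C = "walk.C \<omega> x 0 n (\<lambda>_. undefined)" and ?M = "\<lambda>n. PiM {0..<n} (\<lambda>_. count_space (UNIV :: int set))"
  let ?f = "ennreal (pmf (case n of 0 \<Rightarrow> return_pmf x | Suc j \<Rightarrow> step_law \<omega> (p j)) (p n))"
  have u: "(\<lambda>_. undefined) \<in> space (?M 0)" by (simp add: space_PiM PiE_iff extensional_def)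
  have sC: "sets ?C = sets (?M n)" "space ?C = space (?M n)"
    using walk.sets_C[OF u, of \<omega> x n] walk.space_C[OF u, of \<omega> x n] by simp_all
  have mem: "restrict p {0..<m} \<in> {0..<m} \<rightarrow>\<^sub>E UNIV" for m by auto
  have S: "{restrict p {0..<Suc n}} \<in> sets (?M (Suc n))"
    using mem[of "Suc n"] by (subst sets_PiM_count_space_finite) auto
  have kernel: "emeasure (walk.eP \<omega> x n h) {restrict p {0..<Suc n}} =
      ?f * indicator {restrict p {0..<n}} h"
    if h: "h \<in> space (?M n)" for h
  proof -
    have "h(n := z) = restrict p {0..<Suc n} \<longleftrightarrow> h = restrict p {0..<n} \<and> z = p n" for z
    proof safe
      assume eq: "h(n := z) = restrict p {0..<Suc n}"
      show "z = p n" using fun_cong[OF eq, of n] by simp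
      show "h = restrict p {0..<n}"
      proof
        fix k show "h k = restrict p {0..<n} k"
          using fun_cong[OF eq, of k] h
          by (cases "k = n") (auto simp: space_PiM PiE_iff extensional_def)
      qed
    qed auto
    then have *: "(\<lambda>z. h(n := z)) -` {restrict p {0..<Suc n}} =
        (if h = restrict p {0..<n} then {p n} else {})"
      by (auto simp: vimage_def)
    show ?thesis
      unfolding walk.emeasure_eP[OF h S] *
      by (auto simp: walk_kernel_def emeasure_pmf_single split: nat.split)
  qed
  have "emeasure (walk.C \<omega> x 0 (Suc n) (\<lambda>_. undefined)) {restrict p {0..<Suc n}} =
      (\<integral>\<^sup>+h. emeasure (walk.eP \<omega> x n h) {restrict p {0..<Suc n}} \<partial>?C)"
    using walk.measurable_eP[of \<omega> x n] sC S
    by (simp add: emeasure_bind[where N="?M (Suc n)"] cong: measurable_cong_sets)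
  also have "\<dots> = (\<integral>\<^sup>+h. ?f * indicator {restrict p {0..<n}} h \<partial>?C)"
    using sC by (intro nn_integral_cong kernel) simp
  also have "\<dots> = ?f * emeasure ?C {restrict p {0..<n}}"
    using sC mem[of n] by (intro nn_integral_cmult_indicator) (simp add: sets_PiM_count_space_finite)
  finally show ?case
    unfolding Suc.IH prod.lessThan_Suc by (simp only: mult.commute)
qed

lemma emeasure_walk_law:
  "emeasure (walk_law \<omega> x) {X. \<forall>k\<le>n. X k = p k} =
    ennreal ((if p 0 = x then 1 else 0) * (\<Prod>k<n. pmf (step_law \<omega> (p k)) (p (Suc k))))"
proof -
  let ?J = "{0..<Suc n}"
  let ?q = "\<lambda>k. pmf (case k of 0 \<Rightarrow> return_pmf x | Suc j \<Rightarrow> step_law \<omega> (p j)) (p k)"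
  have eq: "{X. \<forall>k\<le>n. X k = p k} = walk.PF.emb UNIV ?J {restrict p ?J}"
    by (auto simp: prod_emb_def fun_eq_iff restrict_def less_Suc_eq_le) meson
  have S: "{restrict p ?J} \<in> sets (PiM ?J (\<lambda>_. count_space UNIV))"
    by (subst sets_PiM_count_space_finite) auto
  have "emeasure (walk_law \<omega> x) {X. \<forall>k\<le>n. X k = p k} = emeasure (walk.CI \<omega> x ?J) {restrict p ?J}"
    unfolding walk_law_def eq using S by (intro walk.lim) auto
  also have "\<dots> = emeasure (walk.C \<omega> x 0 (Suc n) (\<lambda>_. undefined)) (walk.PF.emb ?J ?J {restrict p ?J})"
    using S by (intro walk.emeasure_CI) auto
  also have "walk.PF.emb ?J ?J {restrict p ?J} = {restrict p ?J}"
    by (rule prod_emb_id) auto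
  also have "emeasure (walk.C \<omega> x 0 (Suc n) (\<lambda>_. undefined)) {restrict p ?J} =
      (\<Prod>k<Suc n. ennreal (?q k))"
    by (rule emeasure_walk_C)
  also have "\<dots> = ennreal (\<Prod>k<Suc n. ?q k)"
    by (rule prod_ennreal) simp
  also have "(\<Prod>k<Suc n. ?q k) =
      (if p 0 = x then 1 else 0) * (\<Prod>k<n. pmf (step_law \<omega> (p k)) (p (Suc k)))"
    by (subst prod.lessThan_Suc_shift) (simp add: pmf_return)
  finally show ?thesis .
qed

lemma prob_space_walk_law: "prob_space (walk_law \<omega> x)"
proof
  have "emeasure (walk_law \<omega> x) (walk.PF.emb UNIV {} {\<lambda>_. undefined}) = emeasure (walk.CI \<omega> x {}) {\<lambda>_. undefined}"
    unfolding walk_law_def by (intro walk.lim) (auto simp: PiM_empty)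
  also have "\<dots> = 1"
    using prob_space.emeasure_space_1[OF walk.PF.prob_space_P[of "{}" \<omega> x]]
    by (simp add: walk.CI_def space_PiM)
  also have "walk.PF.emb UNIV {} {\<lambda>_. undefined} = (UNIV :: (nat \<Rightarrow> int) set)"
    by (auto simp: prod_emb_def restrict_def)
  finally show "emeasure (walk_law \<omega> x) (space (walk_law \<omega> x)) = 1"
    by (simp add: sets_eq_imp_space_eq[OF sets_walk_law] space_PiM)
qed

lemma pmf_step_law:
  assumes "\<omega> y \<in> {0..1}"
  shows "pmf (step_law \<omega> y) z = (if z = y + 1 then \<omega> y else if z = y - 1 then 1 - \<omega> y else 0)"
proof -
  have "(\<lambda>right. if right then y + 1 else y - 1) -` {z} =
      (if z = y + 1 then {True} else if z = y - 1 then {False} else {})"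
    by (auto split: if_splits)
  then show ?thesis
    using assms by (simp add: step_law_def pmf_map measure_pmf_single)
qed


section \<open>Quenched and averaged laws\<close>

text \<open>
  The chains are indexed by their starting point and a label \<open>i \<ge> 1\<close>, so that the trajectory of
  \<open>X\<^sup>x\<^sup>,\<^sup>i\<close> is \<open>X (x, i)\<close>; their independence is that of the coordinates of a product measure.
\<close>

definition quenched :: "(int \<Rightarrow> real) \<Rightarrow> (int \<times> nat \<Rightarrow> nat \<Rightarrow> int) measure" where
  "quenched \<omega> = PiM (UNIV \<times> {1..}) (\<lambda>(x, i). walk_law \<omega> x)"

definition averaged :: "(int \<Rightarrow> real) measure \<Rightarrow> (int \<times> nat \<Rightarrow> nat \<Rightarrow> int) measure" where
  "averaged P = P \<bind> quenched"

text \<open>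
  The Giry monad's bind is only meaningful for a measurable kernel, as verified in
  \<open>measurable_quenched\<close>. The lemma
  \<open>emeasure_averaged\<close> is the defining formula of the averaged law.
\<close>

definition cylinder :: "int list \<Rightarrow> (nat \<Rightarrow> int) set" where
  "cylinder ps = {X. \<forall>k<length ps. X k = ps ! k}"

lemma cylinder_Int:
  assumes "length ps \<le> length qs"
  shows "cylinder ps \<inter> cylinder qs = cylinder qs \<or> cylinder ps \<inter> cylinder qs = {}"
proof (cases "\<forall>k<length ps. ps ! k = qs ! k")
  case True
  with assms have "cylinder qs \<subseteq> cylinder ps" by (auto simp: cylinder_def)
  then show ?thesis by blast
next
  case False
  then obtain k where "k < length ps" "ps ! k \<noteq> qs ! k" by blast
  with assms have "cylinder ps \<inter> cylinder qs = {}" by (force simp: cylinder_def)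
  then show ?thesis ..
qed

lemma Int_stable_cylinders: "Int_stable (insert {} (range cylinder))"
proof -
  have "cylinder ps \<inter> cylinder qs \<in> insert {} (range cylinder)" for ps qs
    using cylinder_Int[of ps qs] cylinder_Int[of qs ps] linear[of "length ps" "length qs"]
    by (metis Int_commute insertCI rangeI)
  then show ?thesis by (auto simp: Int_stable_def)
qed

lemma sets_trajectories: "sets trajectories = sigma_sets UNIV (insert {} (range cylinder))"
proof (rule antisym)
  have m: "cylinder ps \<in> sets trajectories" for ps
  proof -
    have "cylinder ps = {X \<in> space trajectories. \<forall>k<length ps. X k = ps ! k}"
      by (simp add: cylinder_def space_PiM)
    also have "\<dots> \<in> sets trajectories" by measurable
    finally show ?thesis .
  qed
  show "sigma_sets UNIV (insert {} (range cylinder)) \<subseteq> sets trajectories"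
    using sets.sigma_sets_subset[of "insert {} (range cylinder)" trajectories] m
    by (auto simp: space_PiM)
  let ?S = "sigma_sets UNIV (insert {} (range cylinder))"
  have "{X. X i \<in> A} \<in> ?S" for i :: nat and A :: "int set"
  proof -
    let ?L = "{ps. length ps = Suc i \<and> ps ! i \<in> A}"
    have "{X. X i \<in> A} = \<Union> (cylinder ` ?L)"
    proof safe
      fix X :: "nat \<Rightarrow> int" assume "X i \<in> A"
      then have "map X [0..<Suc i] \<in> ?L" "X \<in> cylinder (map X [0..<Suc i])"
        by (auto simp: cylinder_def simp del: upt_Suc)
      then show "X \<in> \<Union> (cylinder ` ?L)" by blast
    qed (auto simp: cylinder_def)
    also have "\<dots> \<in> ?S"
    proof (rule sigma_sets_UNION)
      show "countable (cylinder ` ?L)" by (rule countableI_type[THEN countable_image])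
    qed auto
    finally show ?thesis .
  qed
  then show "sets trajectories \<subseteq> ?S"
    unfolding sets_PiM_single
    by (auto intro!: sigma_sets_mono simp: PiE_UNIV_domain)
qed

lemma measurable_coordinate: "(\<lambda>\<omega>. \<omega> y) \<in> borel_measurable environments"
  unfolding environments_def
  by (rule measurable_compose[OF measurable_component_singleton[of y] measurable_restrict_space1])
    auto

lemma space_environments: "space environments = {\<omega>. \<forall>x. \<omega> x \<in> {0..1}}"
  by (auto simp: environments_def space_PiM space_restrict_space PiE_iff)

lemma measurable_walk_law: "(\<lambda>\<omega>. walk_law \<omega> x) \<in> environments \<rightarrow>\<^sub>M prob_algebra trajectories"
proof (rule measurable_prob_algebra_generated[OF sets_trajectories Int_stable_cylinders])
  fix A assume A: "A \<in> insert {} (range cylinder)"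
  have "(\<lambda>\<omega>. emeasure (walk_law \<omega> x) (cylinder ps)) \<in> borel_measurable environments" for ps
  proof (cases "length ps")
    case 0
    then have "emeasure (walk_law \<omega> x) (cylinder ps) = 1" for \<omega>
      using prob_space.emeasure_space_1[OF prob_space_walk_law[of \<omega> x]]
        sets_eq_imp_space_eq[OF sets_walk_law[of \<omega> x]]
      by (simp add: cylinder_def space_PiM)
    then show ?thesis by simp
  next
    case (Suc n)
    then have c: "cylinder ps = {X. \<forall>k\<le>n. X k = ps ! k}"
      by (auto simp: cylinder_def less_Suc_eq_le)
    have p: "(\<lambda>\<omega>. pmf (step_law \<omega> y) z) \<in> borel_measurable environments" for y z
    proof (subst measurable_cong)
      show "pmf (step_law \<omega> y) z =
          (if z = y + 1 then \<omega> y else if z = y - 1 then 1 - \<omega> y else 0)"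
        if "\<omega> \<in> space environments" for \<omega>
        using that by (intro pmf_step_law) (simp add: space_environments)
    qed (use measurable_coordinate[of y] in auto)
    show ?thesis
      unfolding c emeasure_walk_law using p by measurable
  qed
  with A show "(\<lambda>\<omega>. emeasure (walk_law \<omega> x) A) \<in> borel_measurable environments"
    by auto
qed (auto simp: prob_space_walk_law sets_walk_law)

lemma sets_quenched:
  "sets (quenched \<omega>) = sets (PiM (UNIV \<times> {1..}) (\<lambda>_. trajectories))"
  unfolding quenched_def by (intro sets_PiM_cong) (auto simp: sets_walk_law)

lemma prob_space_quenched: "prob_space (quenched \<omega>)"
  unfolding quenched_def by (intro prob_space_PiM) (auto simp: prob_space_walk_law)

lemma measurable_quenched:
  "quenched \<in> environments \<rightarrow>\<^sub>M prob_algebra (PiM (UNIV \<times> {1..}) (\<lambda>_. trajectories))"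
proof (rule measurable_prob_algebra_generated[OF sets_PiM Int_stable_prod_algebra
      prod_algebra_sets_into_space])
  let ?I = "UNIV \<times> {1..} :: (int \<times> nat) set"
  fix A assume "A \<in> prod_algebra ?I (\<lambda>_. trajectories)"
  then obtain J F where A: "A = prod_emb ?I (\<lambda>_. trajectories) J (Pi\<^sub>E J F)"
    and J: "finite J" "J \<subseteq> ?I" and F: "\<And>j. j \<in> J \<Longrightarrow> F j \<in> sets trajectories"
    by (elim prod_algebraE) auto
  have "emeasure (quenched \<omega>) A = (\<Prod>(x, i)\<in>J. emeasure (walk_law \<omega> x) (F (x, i)))" for \<omega>
  proof -
    have "A = prod_emb ?I (\<lambda>(x, i). walk_law \<omega> x) J (Pi\<^sub>E J F)"
      unfolding A prod_emb_def
      by (auto simp: sets_eq_imp_space_eq[OF sets_walk_law] PiE_iff)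
    then have "emeasure (quenched \<omega>) A = (\<Prod>j\<in>J. emeasure (case j of (x, i) \<Rightarrow> walk_law \<omega> x) (F j))"
      unfolding quenched_def using J F
      by (simp only:) (subst emeasure_PiM_emb, auto simp: prob_space_walk_law sets_walk_law split_beta)
    then show ?thesis by (simp add: split_beta)
  qed
  moreover have "(\<lambda>\<omega>. emeasure (walk_law \<omega> x) (F (x, i))) \<in> borel_measurable environments"
    if "(x, i) \<in> J" for x i
    using measurable_prob_algebraD[OF measurable_walk_law[of x]] F[OF that]
    by (rule measurable_emeasure_kernel)
  ultimately show "(\<lambda>\<omega>. emeasure (quenched \<omega>) A) \<in> borel_measurable environments"
    by (auto intro!: borel_measurable_prod_ennreal simp: split_beta)
qed (auto simp: prob_space_quenched sets_quenched)

lemma sets_averaged: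
  assumes "prob_space P" and "sets P = sets environments"
  shows "sets (averaged P) = sets (PiM (UNIV \<times> {1..}) (\<lambda>_. trajectories))"
  unfolding averaged_def
  by (intro sets_bind sets_quenched) (rule prob_space.not_empty[OF assms(1)])

lemma emeasure_averaged:
  assumes "prob_space P" and "sets P = sets environments"
    and "A \<in> sets (PiM (UNIV \<times> {1..}) (\<lambda>_. trajectories))"
  shows "emeasure (averaged P) A = (\<integral>\<^sup>+\<omega>. emeasure (quenched \<omega>) A \<partial>P)"
  unfolding averaged_def
  using measurable_prob_algebraD[OF measurable_quenched] assms
  by (intro emeasure_bind prob_space.not_empty) (auto cong: measurable_cong_sets)

lemma prob_space_averaged:
  assumes "prob_space P" and "sets P = sets environments"
  shows "prob_space (averaged P)"
  unfolding averaged_def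
  using measurable_prob_algebraD[OF measurable_quenched] assms
  by (intro prob_space.prob_space_bind[OF assms(1)])
    (auto simp: prob_space_quenched cong: measurable_cong_sets)


section \<open>Maximal deviation from the speed\<close>

text \<open>
  Inserting \<open>0\<close> into the set only matters when \<open>Y\<close> or \<open>I\<close> is empty, where the maximum of no numbers
  is read as \<open>0\<close>: this happens for \<open>Y = \<int> \<inter> (An, Bn]\<close> when \<open>n\<close> is small, and for
  \<open>I = {1..n\<^sup>\<gamma>}\<close> when \<open>\<gamma> < 0\<close>.
\<close>

definition max_deviation ::
    "real \<Rightarrow> int set \<Rightarrow> nat set \<Rightarrow> (int \<times> nat \<Rightarrow> nat \<Rightarrow> int) \<Rightarrow> nat \<Rightarrow> real" where
  "max_deviation v Y I X n =
    Max (insert 0 ((\<lambda>(y, i). \<bar>real_of_int (X (y, i) n - y) / real n - v\<bar>) ` (Y \<times> I)))"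

end

theory Submission
  imports Defs "HOL-Real_Asymp.Real_Asymp"
begin

text \<open>
  Let \<open>F x\<close> be the sum over \<open>k < x\<close> of the quenched expected crossing times
  \<open>a k = 1 / \<omega> k + rho \<omega> k * a (k - 1)\<close> from \<open>k\<close> to \<open>k + 1\<close>, so that \<open>F (X n) - n\<close> is a
  martingale. If the crossing times are computed with \<open>\<kappa> * (1 / \<omega>)\<close> and \<open>\<kappa> * rho\<close> for some
  \<open>\<kappa>\<close> slightly different from 1, then \<open>exp (\<theta> * (F (X n) - n))\<close> becomes a
  supermartingale as long as \<open>\<bar>\<theta>\<bar> * a\<close> is small on the sites that can be reached, and
  Markov's inequality bounds the quenched probability of a deviation by
  \<open>exp (- \<bar>\<theta>\<bar> * const * n)\<close>, provided that \<open>a\<close> averages to \<open>1 / speed P\<close> over long blocks.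

  To exclude that the chain is too fast, \<open>a\<close> may be truncated, hence bounded, and \<open>\<theta>\<close> may be
  fixed. To exclude that it is too slow, \<open>a\<close> must not be truncated, but since \<open>\<kappa> * E rho < 1\<close>, first moments
  suffice: on the dyadic scale \<open>2 ^ m\<close>, the terms of \<open>a\<close> of order at most a small multiple of
  \<open>m\<close> obey a law of large numbers by Chebyshev's inequality, while the sum of the remaining
  terms over the whole window has expectation exponentially smaller than \<open>2 ^ m\<close>. So almost
  surely \<open>a\<close> is at most \<open>2 ^ m / m\<^sup>2\<close> on the window, and the deviation probabilities decay
  like \<open>exp (- const * (log n)\<^sup>2)\<close>, faster than any power of the number of chains.
\<close>

section \<open>Marginals of the quenched chain\<close>

text \<open>Each event in the final union bound concerns one chain at one time, so the path measure
  enters only through these one-time marginals.\<close>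

primrec walk_pmf :: "(int \<Rightarrow> real) \<Rightarrow> int \<Rightarrow> nat \<Rightarrow> int pmf" where
  "walk_pmf \<omega> x 0 = return_pmf x"
| "walk_pmf \<omega> x (Suc n) = bind_pmf (walk_pmf \<omega> x n) (step_law \<omega>)"

lemma space_walk_law [simp]: "space (walk_law \<omega> x) = UNIV"
  using sets_eq_imp_space_eq[OF sets_walk_law] by (simp add: space_PiM)

lemma measurable_position [measurable]: "(\<lambda>X. X n) \<in> walk_law \<omega> x \<rightarrow>\<^sub>M count_space UNIV"
  by (simp add: measurable_cong_sets[OF sets_walk_law refl])

lemma cylinder_in_sets: "cylinder ps \<in> sets (walk_law \<omega> x)"
  unfolding sets_walk_law sets_trajectories by (rule sigma_sets.Basic) auto

text \<open>\<open>emeasure_walk_law\<close> evaluates cylinders only. Sorting paths by their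
  history up to time \<open>n\<close> turns an event about \<open>X n\<close> into a disjoint union
  of cylinders, countable because there are countably many integer lists.\<close>

lemma position_eq_UN_cylinder:
  "{X :: nat \<Rightarrow> int. X n = w} = (\<Union>ps\<in>{ps. length ps = Suc n \<and> last ps = w}. cylinder ps)"
proof safe
  fix X :: "nat \<Rightarrow> int"
  let ?ps = "map X [0..<Suc n]"
  have "length ?ps = Suc n" "last ?ps = X n" "X \<in> cylinder ?ps"
    by (auto simp: cylinder_def simp del: upt_Suc) (simp add: last_map)
  then show "X \<in> (\<Union>ps\<in>{ps. length ps = Suc n \<and> last ps = X n}. cylinder ps)"
    by blast
next
  fix X ps assume "length ps = Suc n" "X \<in> cylinder ps"
  then show "X n = last ps"
    by (cases ps rule: rev_cases) (auto simp: cylinder_def)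
qed

lemma disjoint_cylinders:
  "disjoint_family_on cylinder {ps :: int list. length ps = n \<and> Q ps}"
  by (auto simp: disjoint_family_on_def cylinder_def intro: nth_equalityI)

text \<open>The product formula for cylinders gains one factor per time step: this is the Markov
  property on cylinders. A history of length \<open>Suc n\<close> ends at time
  \<open>n\<close>.\<close>

lemma emeasure_cylinder_snoc:
  assumes "length ps = Suc n"
  shows "emeasure (walk_law \<omega> x) (cylinder (ps @ [z])) =
    emeasure (walk_law \<omega> x) (cylinder ps) * pmf (step_law \<omega> (last ps)) z"
proof -
  have 1: "cylinder ps = {X. \<forall>k\<le>n. X k = (ps @ [z]) ! k}"
    using assms by (auto simp: cylinder_def less_Suc_eq_le nth_append)
  have 2: "cylinder (ps @ [z]) = {X. \<forall>k\<le>Suc n. X k = (ps @ [z]) ! k}"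
    using assms by (auto simp: cylinder_def less_Suc_eq_le)
  have 3: "(ps @ [z]) ! n = last ps" "(ps @ [z]) ! Suc n = z"
    using assms by (cases ps rule: rev_cases; simp add: nth_append)+
  show ?thesis
    unfolding 1 2 emeasure_walk_law prod.lessThan_Suc 3
    by (subst ennreal_mult[symmetric]) (auto intro!: prod_nonneg simp: mult.assoc)
qed

text \<open>Sums the one-step factorization over all histories that end in \<open>w\<close>; the
  transition factor depends on the history only through \<open>w\<close> and leaves the sum.\<close>

lemma emeasure_two_positions:
  "emeasure (walk_law \<omega> x) {X. X n = w \<and> X (Suc n) = z} =
    emeasure (walk_law \<omega> x) {X. X n = w} * pmf (step_law \<omega> w) z"
proof -
  let ?T = "{ps :: int list. length ps = Suc n \<and> last ps = w}"
  have eq: "{X. X n = w \<and> X (Suc n) = z} = (\<Union>ps\<in>?T. cylinder (ps @ [z]))"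
  proof -
    have "cylinder (ps @ [z]) = cylinder ps \<inter> {X. X (Suc n) = z}" if "ps \<in> ?T" for ps
      using that by (auto simp: cylinder_def nth_append less_Suc_eq)
    then have "(\<Union>ps\<in>?T. cylinder (ps @ [z])) = {X. X n = w} \<inter> {X. X (Suc n) = z}"
      unfolding position_eq_UN_cylinder[of n w] by blast
    then show ?thesis by auto
  qed
  have disj: "disjoint_family_on (\<lambda>ps. cylinder (ps @ [z])) ?T"
    by (auto simp: disjoint_family_on_def cylinder_def nth_append less_Suc_eq intro!: nth_equalityI)
  have "emeasure (walk_law \<omega> x) {X. X n = w \<and> X (Suc n) = z} =
      (\<integral>\<^sup>+ps. emeasure (walk_law \<omega> x) (cylinder (ps @ [z])) \<partial>count_space ?T)"
    unfolding eq by (intro emeasure_UN_countable disj cylinder_in_sets) auto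
  also have "\<dots> = (\<integral>\<^sup>+ps. emeasure (walk_law \<omega> x) (cylinder ps) * pmf (step_law \<omega> w) z \<partial>count_space ?T)"
    by (intro nn_integral_cong) (auto simp: emeasure_cylinder_snoc)
  also have "\<dots> = (\<integral>\<^sup>+ps. emeasure (walk_law \<omega> x) (cylinder ps) \<partial>count_space ?T) * pmf (step_law \<omega> w) z"
    by (rule nn_integral_multc) auto
  also have "(\<integral>\<^sup>+ps. emeasure (walk_law \<omega> x) (cylinder ps) \<partial>count_space ?T) =
      emeasure (walk_law \<omega> x) {X. X n = w}"
    unfolding position_eq_UN_cylinder
    by (intro emeasure_UN_countable[symmetric] disjoint_cylinders cylinder_in_sets) auto
  finally show ?thesis .
qed

lemma emeasure_position_singleton:
  "emeasure (walk_law \<omega> x) {X. X n = z} = pmf (walk_pmf \<omega> x n) z"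
proof (induction n arbitrary: z)
  case 0
  have "{X. X 0 = z} = cylinder [z]" by (auto simp: cylinder_def)
  also have "\<dots> = {X. \<forall>k\<le>0. X k = (\<lambda>_. z) k}" by (auto simp: cylinder_def)
  finally show ?case
    using emeasure_walk_law[of \<omega> x 0 "\<lambda>_. z"] by (auto simp: pmf_return)
next
  case (Suc n)
  have "emeasure (walk_law \<omega> x) {X. X (Suc n) = z} =
      emeasure (walk_law \<omega> x) (\<Union>w. {X. X n = w \<and> X (Suc n) = z})"
    by (rule arg_cong2[where f=emeasure]) auto
  also have "\<dots> = (\<integral>\<^sup>+w. emeasure (walk_law \<omega> x) {X. X n = w \<and> X (Suc n) = z} \<partial>count_space UNIV)"
  proof (rule emeasure_UN_countable)
    show "{X. X n = w \<and> X (Suc n) = z} \<in> sets (walk_law \<omega> x)" for w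
    proof -
      have "{X \<in> space (walk_law \<omega> x). X n = w \<and> X (Suc n) = z} \<in> sets (walk_law \<omega> x)"
        by measurable
      then show ?thesis by simp
    qed
  qed (auto simp: disjoint_family_on_def)
  also have "\<dots> = (\<integral>\<^sup>+w. ennreal (pmf (walk_pmf \<omega> x n) w) * pmf (step_law \<omega> w) z \<partial>count_space UNIV)"
    unfolding emeasure_two_positions Suc ..
  also have "\<dots> = (\<integral>\<^sup>+w. pmf (step_law \<omega> w) z \<partial>walk_pmf \<omega> x n)"
    by (simp add: nn_integral_measure_pmf)
  also have "\<dots> = pmf (walk_pmf \<omega> x (Suc n)) z"
    by (simp add: ennreal_pmf_bind)
  finally show ?case .
qed

lemma distr_position:
  "distr (walk_law \<omega> x) (count_space UNIV) (\<lambda>X. X n) = measure_pmf (walk_pmf \<omega> x n)"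
proof (rule measure_eqI_countable[where A=UNIV])
  fix z :: int
  have "(\<lambda>X. X n) -` {z} = {X. X n = z}" by auto
  then show "emeasure (distr (walk_law \<omega> x) (count_space UNIV) (\<lambda>X. X n)) {z} =
      emeasure (walk_pmf \<omega> x n) {z}"
    by (simp add: emeasure_distr emeasure_position_singleton emeasure_pmf_single)
qed auto

text \<open>A coordinate of a product of probability measures has its factor as law. The label must
  be at least 1 because the product is indexed by \<open>UNIV \<times> {1..}\<close>.\<close>

lemma emeasure_quenched_position:
  assumes "1 \<le> i"
  shows "emeasure (quenched \<omega>) {X \<in> space (quenched \<omega>). X (y, i) n \<in> S} = emeasure (walk_pmf \<omega> y n) S"
proof -
  have d: "distr (quenched \<omega>) (walk_law \<omega> y) (\<lambda>X. X (y, i)) = walk_law \<omega> y"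
    using distr_PiM_component[of "UNIV \<times> {1..}" "\<lambda>(x, i). walk_law \<omega> x" "(y, i)"] assms
    by (auto simp: quenched_def prob_space_walk_law)
  have m: "(\<lambda>X. X (y, i)) \<in> quenched \<omega> \<rightarrow>\<^sub>M walk_law \<omega> y"
    unfolding quenched_def
    using measurable_component_singleton[of "(y, i)" "UNIV \<times> {1..}" "\<lambda>(x, i). walk_law \<omega> x"] assms
    by simp
  have "emeasure (walk_pmf \<omega> y n) S = emeasure (walk_law \<omega> y) {X. X n \<in> S}"
    unfolding distr_position[symmetric] by (subst emeasure_distr) (auto simp: vimage_def)
  also have "\<dots> = emeasure (distr (quenched \<omega>) (walk_law \<omega> y) (\<lambda>X. X (y, i))) {X. X n \<in> S}"
    unfolding d ..
  also have "\<dots> = emeasure (quenched \<omega>) ((\<lambda>X. X (y, i)) -` {X. X n \<in> S} \<inter> space (quenched \<omega>))"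
  proof (rule emeasure_distr[OF m])
    have "{X \<in> space (walk_law \<omega> y). X n \<in> S} \<in> sets (walk_law \<omega> y)" by measurable
    then show "{X. X n \<in> S} \<in> sets (walk_law \<omega> y)" by simp
  qed
  also have "(\<lambda>X. X (y, i)) -` {X. X n \<in> S} \<inter> space (quenched \<omega>) =
      {X \<in> space (quenched \<omega>). X (y, i) n \<in> S}"
    by auto
  finally show ?thesis ..
qed


section \<open>Exponential supermartingales\<close>

lemma set_step_law: "set_pmf (step_law \<omega> y) \<subseteq> {y - 1, y + 1}"
  by (auto simp: step_law_def)

lemma nn_integral_step_law:
  assumes "\<omega> y \<in> {0..1}" "\<And>z. 0 \<le> g z"
  shows "(\<integral>\<^sup>+z. ennreal (g z) \<partial>step_law \<omega> y) = \<omega> y * g (y + 1) + (1 - \<omega> y) * g (y - 1)"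
  using assms
  by (simp add: step_law_def ennreal_mult'[symmetric] ennreal_plus[symmetric] mult.commute
      del: ennreal_plus)

lemma set_walk_pmf: "z \<in> set_pmf (walk_pmf \<omega> x n) \<Longrightarrow> \<bar>z - x\<bar> \<le> int n"
proof (induction n arbitrary: z)
  case (Suc n)
  then obtain w where w: "w \<in> set_pmf (walk_pmf \<omega> x n)" "z \<in> set_pmf (step_law \<omega> w)"
    by auto
  with Suc.IH[OF w(1)] set_step_law[of \<omega> w] show ?case by fastforce
qed simp

text \<open>The step inequality says that \<open>exp (- \<theta> * n) * g (X n)\<close> is a
  supermartingale; the bound follows by taking expectations step by step. It is required at distance
  strictly less than \<open>n\<close>, since the last step starts at time
  \<open>n - 1\<close>.\<close>

lemma nn_integral_walk_pmf_le:
  assumes \<omega>: "\<And>z. \<bar>z - x\<bar> \<le> int n \<Longrightarrow> \<omega> z \<in> {0..1}"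
    and step: "\<And>z. \<bar>z - x\<bar> < int n \<Longrightarrow> \<omega> z * g (z + 1) + (1 - \<omega> z) * g (z - 1) \<le> exp \<theta> * g z"
    and g: "\<And>z. 0 \<le> (g z :: real)"
  shows "(\<integral>\<^sup>+z. ennreal (g z) \<partial>walk_pmf \<omega> x n) \<le> exp (\<theta> * real n) * g x"
  using \<omega> step
proof (induction n)
  case 0
  then show ?case by (simp add: g)
next
  case (Suc n)
  have "(\<integral>\<^sup>+z. ennreal (g z) \<partial>walk_pmf \<omega> x (Suc n)) =
      (\<integral>\<^sup>+w. (\<integral>\<^sup>+z. ennreal (g z) \<partial>step_law \<omega> w) \<partial>walk_pmf \<omega> x n)"
    by simp
  also have "\<dots> \<le> (\<integral>\<^sup>+w. ennreal (exp \<theta>) * ennreal (g w) \<partial>walk_pmf \<omega> x n)"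
  proof (intro nn_integral_mono_AE, unfold AE_measure_pmf_iff, safe)
    fix w assume "w \<in> set_pmf (walk_pmf \<omega> x n)"
    then have w: "\<bar>w - x\<bar> \<le> int n" by (rule set_walk_pmf)
    then have "(\<integral>\<^sup>+z. ennreal (g z) \<partial>step_law \<omega> w) = \<omega> w * g (w + 1) + (1 - \<omega> w) * g (w - 1)"
      using Suc.prems(1) g by (intro nn_integral_step_law) auto
    also have "\<dots> \<le> ennreal (exp \<theta> * g w)"
      using w by (intro ennreal_leI Suc.prems(2)) auto
    finally show "(\<integral>\<^sup>+z. ennreal (g z) \<partial>step_law \<omega> w) \<le> ennreal (exp \<theta>) * ennreal (g w)"
      by (subst (asm) ennreal_mult) (auto simp: g)
  qed
  also have "\<dots> = ennreal (exp \<theta>) * (\<integral>\<^sup>+w. ennreal (g w) \<partial>walk_pmf \<omega> x n)"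
    by (rule nn_integral_cmult) auto
  also have "\<dots> \<le> ennreal (exp \<theta>) * ennreal (exp (\<theta> * real n) * g x)"
    using Suc.prems by (intro mult_left_mono Suc.IH) auto
  also have "\<dots> = exp (\<theta> * real (Suc n)) * g x"
  proof -
    have "exp \<theta> * (exp (\<theta> * real n) * g x) = exp (\<theta> * real (Suc n)) * g x"
      by (simp add: exp_add distrib_left)
    then show ?thesis by (simp only: ennreal_mult'[OF exp_ge_zero, symmetric])
  qed
  finally show ?case .
qed

lemma walk_pmf_markov:
  assumes \<omega>: "\<And>z. \<bar>z - x\<bar> \<le> int n \<Longrightarrow> \<omega> z \<in> {0..1}"
    and step: "\<And>z. \<bar>z - x\<bar> < int n \<Longrightarrow> \<omega> z * g (z + 1) + (1 - \<omega> z) * g (z - 1) \<le> exp \<theta> * g z"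
    and g: "\<And>z. 0 \<le> (g z :: real)"
    and S: "\<And>z. \<bar>z - x\<bar> \<le> int n \<Longrightarrow> z \<in> S \<Longrightarrow> t \<le> g z" and "0 < t"
  shows "measure (walk_pmf \<omega> x n) S \<le> exp (\<theta> * real n) * g x / t"
proof -
  have "ennreal t * ennreal (measure (walk_pmf \<omega> x n) S) = (\<integral>\<^sup>+z. ennreal t * indicator S z \<partial>walk_pmf \<omega> x n)"
    by (simp add: nn_integral_cmult measure_pmf.emeasure_eq_measure)
  also have "\<dots> \<le> (\<integral>\<^sup>+z. ennreal (g z) \<partial>walk_pmf \<omega> x n)"
    using S set_walk_pmf[of _ \<omega> x n]
    by (intro nn_integral_mono_AE) (auto simp: AE_measure_pmf_iff indicator_def intro!: ennreal_leI)
  also have "\<dots> \<le> exp (\<theta> * real n) * g x"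
    by (rule nn_integral_walk_pmf_le[OF \<omega> step g])
  finally have "t * measure (walk_pmf \<omega> x n) S \<le> exp (\<theta> * real n) * g x"
    using \<open>0 < t\<close> g by (simp add: ennreal_mult[symmetric])
  then show ?thesis
    using \<open>0 < t\<close> by (simp add: field_simps)
qed


section \<open>Elementary exponential inequalities and one-step estimates\<close>

lemma exp_le_quadratic:
  fixes u :: real
  assumes "\<bar>u\<bar> \<le> 1"
  shows "exp u \<le> 1 + u + u\<^sup>2"
proof (cases "0 \<le> u")
  case True
  then show ?thesis using assms by (intro exp_bound) auto
next
  case False
  \<comment> \<open>For negative \<open>u\<close>, take reciprocals in
    \<open>1 + x + x^2 / 2 \<le> exp x\<close> and use
    \<open>(1 - x + x^2 / 2) * (1 + x + x^2 / 2) = 1 + x^4 / 4\<close>.\<close>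
  define x where "x = - u"
  have x: "0 \<le> x" using False by (simp add: x_def)
  have pos: "0 < 1 + x + x\<^sup>2 / 2" using x by (intro add_pos_nonneg) auto
  have "(1 - x + x\<^sup>2 / 2) * (1 + x + x\<^sup>2 / 2) = 1 + (x\<^sup>2 / 2)\<^sup>2"
    by (simp add: field_simps power2_eq_square)
  then have "1 \<le> (1 - x + x\<^sup>2 / 2) * (1 + x + x\<^sup>2 / 2)" by simp
  then have "1 / (1 + x + x\<^sup>2 / 2) \<le> 1 - x + x\<^sup>2 / 2"
    using pos by (simp add: pos_divide_le_eq)
  moreover have "exp u \<le> 1 / (1 + x + x\<^sup>2 / 2)"
    using exp_lower_Taylor_quadratic[OF x] pos
    by (simp add: x_def exp_minus field_simps)
  moreover have "x = - u" "x\<^sup>2 = u\<^sup>2" "0 \<le> u\<^sup>2" by (simp_all add: x_def)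
  ultimately show ?thesis by linarith
qed

text \<open>When \<open>\<bar>\<theta>\<bar> * a\<close> is at most \<open>d\<close>, the quadratic
  Taylor term is at most \<open>d\<close> times the linear one. This relative error is what the
  factor \<kappa> has to absorb.\<close>

lemma exp_mult_le:
  fixes \<theta> a d :: real
  assumes "\<bar>\<theta>\<bar> * a \<le> d" "0 \<le> a" "d \<le> 1"
  shows "exp (\<theta> * a) \<le> 1 + \<theta> * a + d * (\<bar>\<theta>\<bar> * a)"
proof -
  have "(\<theta> * a)\<^sup>2 = (\<bar>\<theta>\<bar> * a) * (\<bar>\<theta>\<bar> * a)"
    using assms(2) by (subst power2_abs[symmetric]) (simp only: abs_mult abs_of_nonneg power2_eq_square)
  also have "\<dots> \<le> d * (\<bar>\<theta>\<bar> * a)"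
    using assms by (intro mult_right_mono) auto
  finally show ?thesis
    using exp_le_quadratic[of "\<theta> * a"] assms by (simp add: abs_mult)
qed

text \<open>Expanding both exponentials, the forward step gains at least
  \<open>(1 - d) * \<beta> * a\<close> and the backward step loses at most
  \<open>(1 + d) * \<beta> * a'\<close>. The factor \<open>(1 + d) / (1 - d)\<close> in the
  recursion pays for both errors and leaves at most \<open>1 - \<beta>\<close>.\<close>

lemma step_lower:
  fixes w a a' d \<beta> :: real
  assumes "0 < w" "w \<le> 1" "0 < d" "d < 1" "0 \<le> \<beta>" "0 \<le> a" "0 \<le> a'" "\<beta> * a \<le> d" "\<beta> * a' \<le> d"
    and rec: "(1 + d) / (1 - d) * (1 / w + (1 - w) / w * a') \<le> a"
  shows "w * exp (- (\<beta> * a)) + (1 - w) * exp (\<beta> * a') \<le> exp (- \<beta>)"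
proof -
  have 1: "exp (- (\<beta> * a)) \<le> 1 - \<beta> * a * (1 - d)"
    using exp_mult_le[of "- \<beta>" a d] assms by (simp add: algebra_simps)
  have 2: "exp (\<beta> * a') \<le> 1 + \<beta> * a' * (1 + d)"
    using exp_mult_le[of "\<beta>" a' d] assms by (simp add: algebra_simps)
  have "(1 + d) * (1 + (1 - w) * a') \<le> (1 - d) * w * a"
    using rec assms by (simp add: field_simps)
  then have "\<beta> * ((1 + d) * (1 + (1 - w) * a')) \<le> \<beta> * ((1 - d) * w * a)"
    using assms by (intro mult_left_mono)
  moreover have "0 \<le> \<beta> * d" using assms by simp
  ultimately have 3: "\<beta> + \<beta> * (1 + d) * (1 - w) * a' \<le> \<beta> * (1 - d) * w * a"
    by (simp add: algebra_simps)
  have "w * exp (- (\<beta> * a)) + (1 - w) * exp (\<beta> * a') \<le>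
      w * (1 - \<beta> * a * (1 - d)) + (1 - w) * (1 + \<beta> * a' * (1 + d))"
    using assms by (intro add_mono mult_left_mono 1 2) auto
  also have "\<dots> \<le> 1 + - \<beta>" using 3 by (simp add: algebra_simps)
  also have "\<dots> \<le> exp (- \<beta>)" by (rule exp_ge_add_one_self)
  finally show ?thesis .
qed

text \<open>The signs of \<open>step_lower\<close> are reversed: \<open>a\<close> must lie below the
  recursion, and the factor is the inverse one.\<close>

lemma step_upper:
  fixes w a a' d \<beta> :: real
  assumes "0 < w" "w \<le> 1" "0 < d" "d < 1" "0 \<le> \<beta>" "0 \<le> a" "0 \<le> a'" "\<beta> * a \<le> d" "\<beta> * a' \<le> d"
    and rec: "a \<le> (1 - d) / (1 + d) * (1 / w + (1 - w) / w * a')"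
  shows "w * exp (\<beta> * a) + (1 - w) * exp (- (\<beta> * a')) \<le> exp \<beta>"
proof -
  have 1: "exp (- (\<beta> * a')) \<le> 1 - \<beta> * a' * (1 - d)"
    using exp_mult_le[of "- \<beta>" a' d] assms by (simp add: algebra_simps)
  have 2: "exp (\<beta> * a) \<le> 1 + \<beta> * a * (1 + d)"
    using exp_mult_le[of "\<beta>" a d] assms by (simp add: algebra_simps)
  have "(1 - d) / (1 + d) * (1 / w + (1 - w) / w * a') = (1 - d) * (1 + (1 - w) * a') / ((1 + d) * w)"
    using assms by (simp add: divide_simps)
  then have "(1 + d) * w * a \<le> (1 - d) * (1 + (1 - w) * a')"
    using rec assms by (simp add: pos_le_divide_eq mult.commute)
  then have "\<beta> * ((1 + d) * w * a) \<le> \<beta> * ((1 - d) * (1 + (1 - w) * a'))"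
    using assms by (intro mult_left_mono)
  moreover have "0 \<le> \<beta> * d" using assms by simp
  ultimately have 3: "\<beta> * (1 + d) * w * a \<le> \<beta> + \<beta> * (1 - d) * (1 - w) * a'"
    by (simp add: algebra_simps)
  have "w * exp (\<beta> * a) + (1 - w) * exp (- (\<beta> * a')) \<le>
      w * (1 + \<beta> * a * (1 + d)) + (1 - w) * (1 - \<beta> * a' * (1 - d))"
    using assms by (intro add_mono mult_left_mono 1 2) auto
  also have "\<dots> \<le> 1 + \<beta>" using 3 by (simp add: algebra_simps)
  also have "\<dots> \<le> exp \<beta>" by (rule exp_ge_add_one_self)
  finally show ?thesis .
qed

section \<open>Tail bounds from super- and subsolutions of the crossing-time recursion\<close>

lemma sum_int_interval_split:
  fixes f :: "int \<Rightarrow> 'a :: comm_monoid_add"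
  assumes "x \<le> y" "y \<le> z"
  shows "sum f {x..<z} = sum f {x..<y} + sum f {y..<z}"
  using assms by (subst sum.union_disjoint[symmetric]) (auto simp: ivl_disj_un_two)

lemma sum_int_interval_Suc:
  fixes f :: "int \<Rightarrow> 'a :: comm_monoid_add"
  assumes "x \<le> y"
  shows "sum f {x..<y + 1} = sum f {x..<y} + f y"
proof -
  have "{y..<y + 1} = {y}" by auto
  then show ?thesis using sum_int_interval_split[of x y "y + 1" f] assms by simp
qed

text \<open>With the potential \<open>F\<close> whose increments are \<open>a\<close>,
  \<open>exp (- \<beta> * F (X n))\<close> shrinks on average by at least the factor
  \<open>exp (- \<beta>)\<close> per step. Since \<open>F\<close> is monotone,
  \<open>X n \<le> y\<close> forces it to be at least \<open>exp (- \<beta> * F y)\<close>, and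
  Markov's inequality applies.\<close>

lemma walk_lower_tail:
  fixes a :: "int \<Rightarrow> real"
  assumes d: "0 < d" "d < 1" and \<beta>: "0 \<le> \<beta>"
    and \<omega>: "\<And>z. s \<le> z \<Longrightarrow> z \<le> u \<Longrightarrow> 0 < \<omega> z \<and> \<omega> z \<le> 1"
    and a: "\<And>z. 0 \<le> a z" "\<And>z. s \<le> z \<Longrightarrow> z < u \<Longrightarrow> \<beta> * a z \<le> d"
    and rec: "\<And>z. s < z \<Longrightarrow> z < u \<Longrightarrow> (1 + d) / (1 - d) * (1 / \<omega> z + rho \<omega> z * a (z - 1)) \<le> a z"
    and win: "s \<le> x - int n" "x + int n \<le> u" "x \<le> y"
  shows "measure (walk_pmf \<omega> x n) {z. z \<le> y} \<le> exp (- (\<beta> * (real n - sum a {x..<y})))"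
proof -
  define F where "F z = sum a {s..<z}" for z
  have F_mono: "F z \<le> F z'" if "z \<le> z'" for z z'
    unfolding F_def using that a by (intro sum_mono2) auto
  have "measure (walk_pmf \<omega> x n) {z. z \<le> y} \<le>
      exp (- \<beta> * real n) * exp (- (\<beta> * F x)) / exp (- (\<beta> * F y))"
  proof (rule walk_pmf_markov)
    fix z assume z: "\<bar>z - x\<bar> < int n"
    \<comment> \<open>The strict bound matters: the increment of \<open>F\<close> from
      \<open>z - 1\<close> to \<open>z\<close> is \<open>a (z - 1)\<close> only if
      \<open>z - 1\<close> is not left of the base point \<open>s\<close>.\<close>
    with win have z': "s < z" "z < u" by auto
    have F1: "F (z + 1) = F z + a z" and F2: "F z = F (z - 1) + a (z - 1)"
      using z' sum_int_interval_Suc[of s z a] sum_int_interval_Suc[of s "z - 1" a]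
      by (auto simp: F_def)
    have "\<omega> z * exp (- (\<beta> * F (z + 1))) + (1 - \<omega> z) * exp (- (\<beta> * F (z - 1))) =
      (\<omega> z * exp (- (\<beta> * a z)) + (1 - \<omega> z) * exp (\<beta> * a (z - 1))) * exp (- (\<beta> * F z))"
      unfolding F1 unfolding F2 by (simp add: algebra_simps flip: exp_add)
    also have "\<dots> \<le> exp (- \<beta>) * exp (- (\<beta> * F z))"
      using z' \<omega>[of z] a rec[of z] d \<beta>
      by (intro mult_right_mono step_lower[where d=d]) (auto simp: rho_def)
    finally show "\<omega> z * exp (- (\<beta> * F (z + 1))) + (1 - \<omega> z) * exp (- (\<beta> * F (z - 1))) \<le>
      exp (- \<beta>) * exp (- (\<beta> * F z))" .
  next
    fix z assume "\<bar>z - x\<bar> \<le> int n"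
    with win have "s \<le> z" "z \<le> u" by auto
    with \<omega>[of z] show "\<omega> z \<in> {0..1}" by auto
  next
    fix z assume "z \<in> {z. z \<le> y}"
    then show "exp (- (\<beta> * F y)) \<le> exp (- (\<beta> * F z))"
      using \<beta> by (auto intro!: mult_left_mono F_mono)
  qed auto
  also have "\<dots> = exp (- (\<beta> * (real n - (F y - F x))))"
    by (simp add: algebra_simps flip: exp_add exp_diff)
  also have "F y - F x = sum a {x..<y}"
    using sum_int_interval_split[of s x y a] win by (simp add: F_def)
  finally show ?thesis .
qed

text \<open>Mirror image of \<open>walk_lower_tail\<close> with a positive exponent: a subsolution
  of the recursion controls the right tail.\<close>

lemma walk_upper_tail:
  fixes a :: "int \<Rightarrow> real"
  assumes d: "0 < d" "d < 1" and \<beta>: "0 \<le> \<beta>"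
    and \<omega>: "\<And>z. s \<le> z \<Longrightarrow> z \<le> u \<Longrightarrow> 0 < \<omega> z \<and> \<omega> z \<le> 1"
    and a: "\<And>z. 0 \<le> a z" "\<And>z. s \<le> z \<Longrightarrow> z < u \<Longrightarrow> \<beta> * a z \<le> d"
    and rec: "\<And>z. s < z \<Longrightarrow> z < u \<Longrightarrow> a z \<le> (1 - d) / (1 + d) * (1 / \<omega> z + rho \<omega> z * a (z - 1))"
    and win: "s \<le> x - int n" "x + int n \<le> u" "x \<le> y"
  shows "measure (walk_pmf \<omega> x n) {z. y \<le> z} \<le> exp (- (\<beta> * (sum a {x..<y} - real n)))"
proof -
  define F where "F z = sum a {s..<z}" for z
  have F_mono: "F z \<le> F z'" if "z \<le> z'" for z z'
    unfolding F_def using that a by (intro sum_mono2) auto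
  have "measure (walk_pmf \<omega> x n) {z. y \<le> z} \<le>
      exp (\<beta> * real n) * exp (\<beta> * F x) / exp (\<beta> * F y)"
  proof (rule walk_pmf_markov)
    fix z assume z: "\<bar>z - x\<bar> < int n"
    with win have z': "s < z" "z < u" by auto
    have F1: "F (z + 1) = F z + a z" and F2: "F z = F (z - 1) + a (z - 1)"
      using z' sum_int_interval_Suc[of s z a] sum_int_interval_Suc[of s "z - 1" a]
      by (auto simp: F_def)
    have "\<omega> z * exp (\<beta> * F (z + 1)) + (1 - \<omega> z) * exp (\<beta> * F (z - 1)) =
      (\<omega> z * exp (\<beta> * a z) + (1 - \<omega> z) * exp (- (\<beta> * a (z - 1)))) * exp (\<beta> * F z)"
      unfolding F1 unfolding F2 by (simp add: algebra_simps flip: exp_add)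
    also have "\<dots> \<le> exp \<beta> * exp (\<beta> * F z)"
      using z' \<omega>[of z] a rec[of z] d \<beta>
      by (intro mult_right_mono step_upper[where d=d]) (auto simp: rho_def)
    finally show "\<omega> z * exp (\<beta> * F (z + 1)) + (1 - \<omega> z) * exp (\<beta> * F (z - 1)) \<le>
      exp \<beta> * exp (\<beta> * F z)" .
  next
    fix z assume "\<bar>z - x\<bar> \<le> int n"
    with win have "s \<le> z" "z \<le> u" by auto
    with \<omega>[of z] show "\<omega> z \<in> {0..1}" by auto
  next
    fix z assume "z \<in> {z. y \<le> z}"
    then show "exp (\<beta> * F y) \<le> exp (\<beta> * F z)"
      using \<beta> by (auto intro!: mult_left_mono F_mono)
  qed auto
  also have "\<dots> = exp (- (\<beta> * ((F y - F x) - real n)))"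
    by (simp add: algebra_simps flip: exp_add exp_diff)
  also have "F y - F x = sum a {x..<y}"
    using sum_int_interval_split[of s x y a] win by (simp add: F_def)
  finally show ?thesis .
qed


section \<open>Sums over blocks\<close>

lemma sum_block_union:
  fixes f :: "int \<Rightarrow> real" and h :: int and \<tau> :: real
  assumes "0 < h" "i \<le> j"
  shows "sum f {i * h..<j * h} = (\<Sum>l\<in>{i..<j}. sum f {l * h..<(l + 1) * h})"
  using assms(2)
proof (induction j rule: int_ge_induct)
  case (step j)
  have "sum f {i * h..<(j + 1) * h} = sum f {i * h..<j * h} + sum f {j * h..<(j + 1) * h}"
    using step.hyps assms(1) by (intro sum_int_interval_split mult_right_mono) auto
  with step show ?case by (simp add: sum_int_interval_Suc)
qed simp

lemma int_div_bounds:
  fixes x h :: int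
  assumes "0 < h"
  shows "x div h * h \<le> x" "x < x div h * h + h"
  using assms div_mult_mod_eq[of x h] pos_mod_sign[of h x] pos_mod_bound[of h x] by linarith+

text \<open>The interval is enlarged to a union of whole blocks, which adds at most one block length
  at each end; hence the \<open>2 * h\<close>.\<close>

lemma sum_le_blocks:
  fixes f :: "int \<Rightarrow> real" and h :: int and \<tau> :: real
  assumes h: "0 < h" and f: "\<And>k. 0 \<le> f k" and "0 \<le> \<tau>"
    and blocks: "\<And>i. - I \<le> i \<Longrightarrow> i < I \<Longrightarrow> sum f {i * h..<(i + 1) * h} \<le> \<tau> * h"
    and xy: "- I * h \<le> x" "x \<le> y" "y < I * h"
  shows "sum f {x..<y} \<le> \<tau> * of_int (y - x + 2 * h)"
proof -
  define i j where "i = x div h" and "j = y div h + 1"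
  have x: "i * h \<le> x" "x < i * h + h" and y: "(j - 1) * h \<le> y" "y < j * h"
    using int_div_bounds[OF h, of x] int_div_bounds[OF h, of y]
    by (simp_all add: i_def j_def algebra_simps)
  have "- I * h < (i + 1) * h" using xy(1) x(2) by (simp add: algebra_simps)
  then have "- I < i + 1" using h mult_less_cancel_right_pos[OF h, of "- I" "i + 1"] by blast
  then have "- I \<le> i" by simp
  have "(j - 1) * h < I * h" using y(1) xy(3) by linarith
  then have "j \<le> I" using h by simp
  have "x div h \<le> y div h" using xy h by (intro zdiv_mono1) auto
  then have ij: "i \<le> j" by (simp add: i_def j_def)
  have "sum f {x..<y} \<le> sum f {i * h..<j * h}"
    using x y f by (intro sum_mono2) auto
  also have "\<dots> = (\<Sum>l\<in>{i..<j}. sum f {l * h..<(l + 1) * h})"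
    by (rule sum_block_union[OF h ij])
  also have "\<dots> \<le> (\<Sum>l\<in>{i..<j}. \<tau> * h)"
    using \<open>- I \<le> i\<close> \<open>j \<le> I\<close> by (intro sum_mono blocks) auto
  also have "\<dots> = \<tau> * of_int ((j - i) * h)"
    using ij by (simp add: algebra_simps)
  also have "\<dots> \<le> \<tau> * of_int (y - x + 2 * h)"
    using \<open>0 \<le> \<tau>\<close> x y by (intro mult_left_mono) (auto simp only: of_int_le_iff, simp add: algebra_simps)
  finally show ?thesis by simp
qed

text \<open>The interval is shrunk to the whole blocks inside it, which loses at most one block
  length at each end.\<close>

lemma sum_ge_blocks:
  fixes f :: "int \<Rightarrow> real" and h :: int and \<tau> :: real
  assumes h: "0 < h" and f: "\<And>k. 0 \<le> f k" and "0 \<le> \<tau>"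
    and blocks: "\<And>i. - I \<le> i \<Longrightarrow> i < I \<Longrightarrow> \<tau> * h \<le> sum f {i * h..<(i + 1) * h}"
    and xy: "- I * h \<le> x" "x \<le> y" "y < I * h"
  shows "\<tau> * of_int (y - x - 2 * h) \<le> sum f {x..<y}"
proof -
  define i j where "i = x div h + 1" and "j = y div h"
  have x: "(i - 1) * h \<le> x" "x < i * h" and y: "j * h \<le> y" "y < j * h + h"
    using int_div_bounds[OF h, of x] int_div_bounds[OF h, of y]
    by (simp_all add: i_def j_def algebra_simps)
  have "- I * h < i * h" using xy(1) x(2) by linarith
  then have "- I \<le> i" using mult_less_cancel_right_pos[OF h, of "- I" i] by simp
  have "j * h < I * h" using y(1) xy(3) by linarith
  then have "j \<le> I" using h by simp
  show ?thesis
  proof (cases "i \<le> j")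
    case True
    have "\<tau> * of_int (y - x - 2 * h) \<le> \<tau> * of_int ((j - i) * h)"
      using \<open>0 \<le> \<tau>\<close> x y by (intro mult_left_mono) (auto simp only: of_int_le_iff, simp add: algebra_simps)
    also have "\<dots> = (\<Sum>l\<in>{i..<j}. \<tau> * h)"
      using True by (simp add: algebra_simps)
    also have "\<dots> \<le> (\<Sum>l\<in>{i..<j}. sum f {l * h..<(l + 1) * h})"
      using \<open>- I \<le> i\<close> \<open>j \<le> I\<close> by (intro sum_mono blocks) auto
    also have "\<dots> = sum f {i * h..<j * h}"
      by (rule sum_block_union[OF h True, symmetric])
    also have "\<dots> \<le> sum f {x..<y}"
      using x y f by (intro sum_mono2) auto
    finally show ?thesis .
  next
    \<comment> \<open>Here \<open>x\<close> and \<open>y\<close> lie in the same block, so the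
      left-hand side is not positive.\<close>
    case False
    then have "(j + 1) * h \<le> i * h" using h by (intro mult_right_mono) auto
    then have "y - x - 2 * h \<le> 0" using x y by (simp add: algebra_simps)
    then have "real_of_int (y - x - 2 * h) \<le> 0"
      by (simp only: of_int_le_0_iff)
    then have "\<tau> * of_int (y - x - 2 * h) \<le> 0"
      using \<open>0 \<le> \<tau>\<close> by (simp add: mult_nonneg_nonpos)
    also have "0 \<le> sum f {x..<y}" using f by (intro sum_nonneg)
    finally show ?thesis .
  qed
qed


section \<open>Truncated crossing times\<close>

text \<open>
  For \<open>\<kappa> = 1\<close> and \<open>J \<longlonglongrightarrow> \<infinity>\<close> this converges to the quenched mean
  time to reach \<open>x + 1\<close> from \<open>x\<close>.
\<close>

primrec crossing :: "real \<Rightarrow> (int \<Rightarrow> real) \<Rightarrow> nat \<Rightarrow> int \<Rightarrow> real" where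
  "crossing \<kappa> \<omega> 0 x = 0"
| "crossing \<kappa> \<omega> (Suc J) x = \<kappa> * (1 / \<omega> x + rho \<omega> x * crossing \<kappa> \<omega> J (x - 1))"

lemma rho_nonneg: "0 < \<omega> x \<Longrightarrow> \<omega> x \<le> 1 \<Longrightarrow> 0 \<le> rho \<omega> x"
  by (simp add: rho_def)

lemma crossing_nonneg:
  assumes "0 \<le> \<kappa>" "\<And>x. 0 < \<omega> x \<and> \<omega> x \<le> 1"
  shows "0 \<le> crossing \<kappa> \<omega> J x"
  by (induction J arbitrary: x)
    (auto intro!: mult_nonneg_nonneg add_nonneg_nonneg simp: assms rho_nonneg less_imp_le)

text \<open>The recursion is monotone because \<kappa> and \<open>rho\<close> are nonnegative, and
  it starts from 0. Consequently a crossing time with fixed \<open>J\<close> is a subsolution, the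
  form required by \<open>walk_upper_tail\<close>.\<close>

lemma crossing_le_Suc:
  assumes "0 \<le> \<kappa>" "\<And>x. 0 < \<omega> x \<and> \<omega> x \<le> 1"
  shows "crossing \<kappa> \<omega> J x \<le> crossing \<kappa> \<omega> (Suc J) x"
proof (induction J arbitrary: x)
  case 0
  show ?case using crossing_nonneg[OF assms, where J="Suc 0" and x=x] by simp
next
  case (Suc J)
  show ?case
    unfolding crossing.simps(2)[of _ _ "Suc J"] crossing.simps(2)[of _ _ J]
    using assms by (intro mult_left_mono add_left_mono Suc[unfolded crossing.simps]) (auto simp: rho_nonneg)
qed

lemma crossing_mono:
  assumes "0 \<le> \<kappa>" "\<And>x. 0 < \<omega> x \<and> \<omega> x \<le> 1" "J \<le> J'"
  shows "crossing \<kappa> \<omega> J x \<le> crossing \<kappa> \<omega> J' x"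
  using crossing_le_Suc[OF assms(1,2)] assms(3) by (rule lift_Suc_mono_le)

text \<open>Ellipticity bounds both \<open>1 / \<omega> x\<close> and \<open>rho \<omega> x\<close>
  by \<open>1 / c\<close>. The base is at least 1, so the inhomogeneous term is dominated by the
  same power and a factor \<open>2 * \<kappa> / c\<close> per level suffices.\<close>

lemma crossing_le_power:
  assumes "0 \<le> \<kappa>" "0 < c" "\<And>x. \<omega> x \<in> {c..1 - c}"
  shows "crossing \<kappa> \<omega> J x \<le> (1 + 2 * \<kappa> / c) ^ J"
proof (induction J arbitrary: x)
  case (Suc J)
  let ?L = "1 + 2 * \<kappa> / c"
  have L: "1 \<le> ?L" using assms by simp
  have \<omega>: "c \<le> \<omega> x" "\<omega> x \<le> 1" for x using assms(2) assms(3)[of x] by auto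
  have "1 / \<omega> x \<le> 1 / c" using assms(2) \<omega>(1)[of x] by (simp add: frac_le)
  moreover have "rho \<omega> x \<le> 1 / c"
    unfolding rho_def using assms(2) \<omega>[of x] by (intro frac_le) auto
  moreover have "0 \<le> crossing \<kappa> \<omega> J (x - 1)"
    using assms(1,2) \<omega> by (intro crossing_nonneg) (auto intro: less_le_trans)
  ultimately have "crossing \<kappa> \<omega> (Suc J) x \<le> \<kappa> * (1 / c + 1 / c * ?L ^ J)"
    using assms(1,2) Suc[of "x - 1"]
    unfolding crossing.simps by (intro mult_left_mono add_mono mult_mono) auto
  also have "\<dots> \<le> \<kappa> * (1 / c * ?L ^ J + 1 / c * ?L ^ J)"
    using assms(1,2) one_le_power[OF L, of J]
    by (intro mult_left_mono add_mono) (auto simp: divide_right_mono)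
  also have "\<dots> \<le> ?L * ?L ^ J"
    using L by (simp add: algebra_simps)
  finally show ?case by simp
qed simp


section \<open>From dyadic scales to deviation probabilities\<close>

text \<open>The environment is controlled for large dyadic block lengths \<open>2 ^ m\<close>. Each
  large \<open>n\<close> is matched with the \<open>m\<close> for which \<open>n div Q\<close> lies
  in \<open>[2 ^ m, 2 ^ (m + 1))\<close>, so that blocks have length between
  \<open>n / (2 * Q)\<close> and \<open>n / Q\<close>.\<close>

lemma eventually_dyadic:
  fixes P :: "nat \<Rightarrow> bool"
  assumes P: "\<forall>\<^sub>F m in sequentially. P m" and "0 < Q"
  shows "\<forall>\<^sub>F n in sequentially. \<exists>m. P m \<and> Q * 2 ^ m \<le> n \<and> n < 2 * Q * 2 ^ m"
proof -
  obtain M where M: "\<And>m. M \<le> m \<Longrightarrow> P m"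
    using P by (auto simp: eventually_sequentially)
  show ?thesis
  proof (rule eventually_sequentiallyI[of "2 * Q * 2 ^ M"])
    fix n assume n: "2 * Q * 2 ^ M \<le> n"
    have "Q \<le> n" using n le_trans[of Q "2 * Q * 2 ^ M" n] by (simp add: mult.assoc)
    then have "1 \<le> n div Q" using \<open>0 < Q\<close> by (simp add: div_greater_zero_iff Suc_le_eq)
    then obtain m where m: "2 ^ m \<le> n div Q" "n div Q < 2 ^ (m + 1)"
      using ex_power_ivl1[of 2 "n div Q"] by auto
    have 1: "Q * 2 ^ m \<le> n"
      using m(1) \<open>0 < Q\<close> by (metis less_eq_div_iff_mult_less_eq mult.commute)
    have 2: "n < 2 * Q * 2 ^ m"
      using m(2) \<open>0 < Q\<close> by (simp add: div_less_iff_less_mult algebra_simps)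
    have "\<not> m < M"
    proof
      assume "m < M"
      then have "(2::nat) ^ m \<le> 2 ^ M" by simp
      then have "2 * Q * 2 ^ m \<le> 2 * Q * 2 ^ M" by simp
      with n 2 show False by simp
    qed
    with M[of m] 1 2 show "\<exists>m. P m \<and> Q * 2 ^ m \<le> n \<and> n < 2 * Q * 2 ^ m"
      by (intro exI[of _ m] conjI) auto
  qed
qed

text \<open>
  Choosing the truncation level of \<open>a m\<close> at site \<open>k\<close> as the distance to the left end of the
  window makes the recursion exact inside the window without an infinite series.
\<close>

lemma slow_deviation:
  fixes I :: int and \<tau> w c d :: real
  assumes \<omega>: "0 < c" "\<And>x. \<omega> x \<in> {c..1 - c}"
    and d: "0 < d" "d < 1" and \<kappa>: "\<kappa> = (1 + d) / (1 - d)" and Q: "0 < Q"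
    and I: "I = 2 * int Q * (int W + 2)"
    and a: "\<And>m k. a m k = crossing \<kappa> \<omega> (nat (k + I * 2 ^ m + 1)) k"
    and good: "\<forall>\<^sub>F m in sequentially.
      (\<forall>i. - I \<le> i \<longrightarrow> i < I \<longrightarrow> sum (a m) {i * 2 ^ m..<(i + 1) * 2 ^ m} \<le> \<tau> * 2 ^ m) \<and>
      (\<forall>k. - I * 2 ^ m \<le> k \<longrightarrow> k < I * 2 ^ m \<longrightarrow> (real m + 1)\<^sup>2 * a m k \<le> 2 ^ m)"
    and w: "0 \<le> w" "w \<le> 1" and \<tau>: "0 \<le> \<tau>" "(w + 2 / real Q) * \<tau> < 1"
  shows "\<exists>C>0. \<forall>\<^sub>F n in sequentially. \<forall>x. \<bar>x\<bar> \<le> int W * int n \<longrightarrow>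
    measure (walk_pmf \<omega> x n) {z. of_int z \<le> of_int x + w * real n} \<le> exp (- (C * (log 2 (real n / real Q))\<^sup>2))"
proof -
  \<comment> \<open>Covering the distance \<open>w * n\<close> by blocks of length at most
    \<open>n / Q\<close> costs time at most \<open>(w + 2 / Q) * \<tau> * n\<close>; \<xi> is the
    fraction of \<open>n\<close> left over.\<close>
  define \<xi> where "\<xi> = 1 - (w + 2 / real Q) * \<tau>"
  define C where "C = d * \<xi> * Q"
  have \<xi>: "0 < \<xi>" using \<tau> by (simp add: \<xi>_def)
  then have "0 < C" using d Q by (simp add: C_def)
  have \<omega>01: "0 < \<omega> x \<and> \<omega> x \<le> 1" for x using \<omega>(1) \<omega>(2)[of x] by auto
  have "0 \<le> \<kappa>" using d \<kappa> by simp
  have a_nonneg: "0 \<le> a m k" for m k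
    unfolding a by (rule crossing_nonneg[OF \<open>0 \<le> \<kappa>\<close> \<omega>01])
  have "\<forall>\<^sub>F n in sequentially. \<forall>x. \<bar>x\<bar> \<le> int W * int n \<longrightarrow>
    measure (walk_pmf \<omega> x n) {z. of_int z \<le> of_int x + w * real n} \<le> exp (- (C * (log 2 (real n / real Q))\<^sup>2))"
    using eventually_dyadic[OF good Q]
  proof eventually_elim
    case (elim n)
    then obtain m where blocks: "\<And>i. - I \<le> i \<Longrightarrow> i < I \<Longrightarrow> sum (a m) {i * 2 ^ m..<(i + 1) * 2 ^ m} \<le> \<tau> * 2 ^ m"
      and a_le: "\<And>k. - I * 2 ^ m \<le> k \<Longrightarrow> k < I * 2 ^ m \<Longrightarrow> (real m + 1)\<^sup>2 * a m k \<le> 2 ^ m"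
      and n: "Q * 2 ^ m \<le> n" "n < 2 * Q * 2 ^ m"
      by blast
    define h :: int where "h = 2 ^ m"
    \<comment> \<open>The largest exponent that the bound \<open>2 ^ m / (m + 1)^2\<close> on
      \<open>a m\<close> permits if \<open>\<beta> * a m\<close> is to stay below \<open>d\<close>.
      As \<open>n\<close> is at least \<open>Q * 2 ^ m\<close>, the product
      \<open>\<beta> * \<xi> * n\<close> is at least \<open>C * (m + 1)^2\<close>.\<close>
    define \<beta> where "\<beta> = d * (real m + 1)\<^sup>2 / 2 ^ m"
    have h: "0 < h" by (simp add: h_def)
    have "real (Q * 2 ^ m) \<le> real n" using n by (simp only: of_nat_le_iff)
    then have hn: "2 ^ m \<le> real n / real Q" using Q by (simp add: field_simps)
    have "0 < n" using n(1) Q by (metis gr0I mult_eq_0_iff not_le power_not_zero zero_neq_numeral)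
    have "real n < real (2 * Q * 2 ^ m)" using n by (simp only: of_nat_less_iff)
    then have "real n / real Q < 2 ^ (m + 1)" using Q by (simp add: field_simps)
    \<comment> \<open>The scale \<open>m\<close> depends on \<open>n\<close>; this inequality lets
      the final bound be written in terms of \<open>n\<close> alone.\<close>
    then have "log 2 (real n / real Q) < real (m + 1)"
      using \<open>0 < n\<close> Q by (simp add: log_less_iff powr_add powr_realpow)
    moreover have "1 \<le> real n / real Q" using hn one_le_power[of "2::real" m] by linarith
    then have "0 \<le> log 2 (real n / real Q)" by simp
    ultimately have log_le: "(log 2 (real n / real Q))\<^sup>2 \<le> (real m + 1)\<^sup>2"
      by (intro power_mono) auto
    show ?case
    proof (intro allI impI)
      fix x :: int assume x: "\<bar>x\<bar> \<le> int W * int n"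
      define y where "y = x + \<lfloor>w * real n\<rfloor>"
      have wn: "w * real n \<le> real n" using w by (simp add: mult_left_le_one_le)
      have y: "x \<le> y" "y \<le> x + int n"
        using w wn by (auto simp: y_def le_floor_iff floor_le_iff)
      have "int n < int (2 * Q * 2 ^ m)" using n(2) by (simp only: of_nat_less_iff)
      then have "int n < 2 * int Q * h" by (simp add: h_def)
      \<comment> \<open>The window radius \<open>I * h\<close> exceeds \<open>(W + 2) * n\<close>:
        the start lies within \<open>W * n\<close> of the origin, and \<open>2 * n\<close> more is
        available on either side.\<close>
      then have "(int W + 2) * int n < (int W + 2) * (2 * int Q * h)"
        by (intro mult_strict_left_mono) auto
      then have win: "\<bar>x\<bar> + 2 * int n < I * h"
        using x by (simp add: I algebra_simps)
      have set_eq: "{z. of_int z \<le> of_int x + w * real n} = {z. z \<le> y}"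
      proof -
        have "of_int z \<le> of_int x + w * real n \<longleftrightarrow> z \<le> y" for z :: int
        proof -
          have "of_int z \<le> of_int x + w * real n \<longleftrightarrow> of_int (z - x) \<le> w * real n"
            by (simp add: algebra_simps)
          also have "\<dots> \<longleftrightarrow> z - x \<le> \<lfloor>w * real n\<rfloor>" by (rule le_floor_iff[symmetric])
          finally show ?thesis by (auto simp: y_def)
        qed
        then show ?thesis by auto
      qed
      have "measure (walk_pmf \<omega> x n) {z. z \<le> y} \<le> exp (- (\<beta> * (real n - sum (a m) {x..<y})))"
      proof (rule walk_lower_tail[OF d])
        show "0 \<le> \<beta>" using d by (simp add: \<beta>_def)
        show "\<beta> * a m z \<le> d" if "- I * h \<le> z" "z < I * h" for z
        proof -
          have "d * ((real m + 1)\<^sup>2 * a m z) \<le> d * 2 ^ m"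
            using a_le[of z] that d by (intro mult_left_mono) (auto simp: h_def)
          then show ?thesis by (simp add: \<beta>_def field_simps)
        qed
        show "(1 + d) / (1 - d) * (1 / \<omega> z + rho \<omega> z * a m (z - 1)) \<le> a m z"
          if "- I * h < z" "z < I * h" for z
        proof -
          have "nat (z + I * 2 ^ m + 1) = Suc (nat (z - 1 + I * 2 ^ m + 1))"
            using that by (simp add: h_def nat_eq_iff2 Suc_nat_eq_nat_zadd1)
          then show ?thesis by (simp add: a \<kappa>)
        qed
      qed (use \<omega>01 a_nonneg win y in auto)
      also have "exp (- (\<beta> * (real n - sum (a m) {x..<y}))) \<le> exp (- (C * (log 2 (real n / real Q))\<^sup>2))"
      proof -
        have "sum (a m) {x..<y} \<le> \<tau> * of_int (y - x + 2 * h)"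
          by (rule sum_le_blocks[where I=I]) (use h a_nonneg \<tau> blocks win y in \<open>auto simp: h_def\<close>)
        also have "\<dots> \<le> \<tau> * (w * real n + 2 * (real n / real Q))"
          using \<tau> hn by (intro mult_left_mono) (auto simp: y_def h_def intro!: add_mono)
        also have "\<dots> = real n - \<xi> * real n" by (simp add: \<xi>_def algebra_simps)
        finally have "\<xi> * real n \<le> real n - sum (a m) {x..<y}" by simp
        moreover have "\<xi> * (Q * 2 ^ m) \<le> \<xi> * real n"
          using \<xi> hn Q by (intro mult_left_mono) (auto simp: field_simps)
        ultimately have "\<beta> * (\<xi> * (Q * 2 ^ m)) \<le> \<beta> * (real n - sum (a m) {x..<y})"
          using d by (intro mult_left_mono) (auto simp: \<beta>_def)
        moreover have "\<beta> * (\<xi> * (Q * 2 ^ m)) = C * (real m + 1)\<^sup>2"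
          by (simp add: \<beta>_def C_def)
        moreover have "C * (log 2 (real n / real Q))\<^sup>2 \<le> C * (real m + 1)\<^sup>2"
          using \<open>0 < C\<close> log_le by (intro mult_left_mono) auto
        ultimately show ?thesis unfolding exp_le_cancel_iff neg_le_iff_le by linarith
      qed
      finally show "measure (walk_pmf \<omega> x n) {z. of_int z \<le> of_int x + w * real n} \<le> exp (- (C * (log 2 (real n / real Q))\<^sup>2))"
        unfolding set_eq by simp
    qed
  qed
  with \<open>0 < C\<close> show ?thesis by blast
qed

text \<open>With a fixed level \<open>J\<close> the crossing times are bounded by a constant
  \<open>L\<close>, so the exponent \<open>d / L\<close> is independent of \<open>n\<close> and the
  decay is exponential. The whole blocks on the way give a crossing time of at least
  \<open>(w - 2 / Q) * \<tau> * n\<close>, more than \<open>n\<close>.\<close>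

lemma fast_deviation:
  fixes I :: int and \<tau> w c d :: real
  assumes \<omega>: "0 < c" "\<And>x. \<omega> x \<in> {c..1 - c}"
    and d: "0 < d" "d < 1" and \<kappa>: "\<kappa> = (1 - d) / (1 + d)" and Q: "0 < Q"
    and I: "I = 2 * int Q * (int W + 2)"
    and good: "\<forall>\<^sub>F m in sequentially. \<forall>i. - I \<le> i \<longrightarrow> i < I \<longrightarrow>
      \<tau> * 2 ^ m \<le> sum (crossing \<kappa> \<omega> J) {i * 2 ^ m..<(i + 1) * 2 ^ m}"
    and w: "0 \<le> w" "w \<le> 2" and \<tau>: "0 \<le> \<tau>" "1 < (w - 2 / real Q) * \<tau>"
  shows "\<exists>C>0. \<forall>\<^sub>F n in sequentially. \<forall>x. \<bar>x\<bar> \<le> int W * int n \<longrightarrow>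
    measure (walk_pmf \<omega> x n) {z. of_int x + w * real n \<le> of_int z} \<le> exp (- (C * real n))"
proof -
  define \<xi> where "\<xi> = (w - 2 / real Q) * \<tau> - 1"
  have \<omega>01: "0 < \<omega> x \<and> \<omega> x \<le> 1" for x using \<omega>(1) \<omega>(2)[of x] by auto
  have "0 \<le> \<kappa>" using d \<kappa> by simp
  define L where "L = (1 + 2 * \<kappa> / c) ^ J"
  define C where "C = d / L * \<xi>"
  have \<xi>: "0 < \<xi>" using \<tau> by (simp add: \<xi>_def)
  have L: "0 < L" using \<open>0 \<le> \<kappa>\<close> \<omega>(1) by (auto simp: L_def intro!: zero_less_power add_pos_nonneg)
  have "0 < C" using d \<xi> L by (simp add: C_def)
  let ?b = "crossing \<kappa> \<omega> J"
  have b_nonneg: "0 \<le> ?b k" for k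
    by (rule crossing_nonneg[OF \<open>0 \<le> \<kappa>\<close> \<omega>01])
  have "\<forall>\<^sub>F n in sequentially. \<forall>x. \<bar>x\<bar> \<le> int W * int n \<longrightarrow>
    measure (walk_pmf \<omega> x n) {z. of_int x + w * real n \<le> of_int z} \<le> exp (- (C * real n))"
    using eventually_dyadic[OF good Q]
  proof eventually_elim
    case (elim n)
    then obtain m where blocks: "\<And>i. - I \<le> i \<Longrightarrow> i < I \<Longrightarrow> \<tau> * 2 ^ m \<le> sum ?b {i * 2 ^ m..<(i + 1) * 2 ^ m}"
      and n: "Q * 2 ^ m \<le> n" "n < 2 * Q * 2 ^ m"
      by blast
    define h :: int where "h = 2 ^ m"
    have h: "0 < h" by (simp add: h_def)
    have "real (Q * 2 ^ m) \<le> real n" using n by (simp only: of_nat_le_iff)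
    then have hn: "2 ^ m \<le> real n / real Q" using Q by (simp add: field_simps)
    show ?case
    proof (intro allI impI)
      fix x :: int assume x: "\<bar>x\<bar> \<le> int W * int n"
      define y where "y = x + \<lceil>w * real n\<rceil>"
      \<comment> \<open>As \<open>w\<close> may exceed 1, the target \<open>y\<close> can lie up to
        \<open>2 * n\<close> to the right of \<open>x\<close>; this is why the window leaves that
        much room.\<close>
      have "w * real n \<le> 2 * real n" using w by (intro mult_right_mono) auto
      moreover have "0 \<le> w * real n" using w by simp
      ultimately have y: "x \<le> y" "y \<le> x + 2 * int n"
        by (simp_all add: y_def ceiling_le_iff)
      have "int n < int (2 * Q * 2 ^ m)" using n(2) by (simp only: of_nat_less_iff)
      then have "int n < 2 * int Q * h" by (simp add: h_def)
      then have "(int W + 2) * int n < (int W + 2) * (2 * int Q * h)"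
        by (intro mult_strict_left_mono) auto
      then have win: "\<bar>x\<bar> + 2 * int n < I * h"
        using x by (simp add: I algebra_simps)
      have set_eq: "{z. of_int x + w * real n \<le> of_int z} = {z. y \<le> z}"
      proof -
        have "of_int x + w * real n \<le> of_int z \<longleftrightarrow> y \<le> z" for z :: int
        proof -
          have "of_int x + w * real n \<le> of_int z \<longleftrightarrow> w * real n \<le> of_int (z - x)"
            by (simp add: algebra_simps)
          also have "\<dots> \<longleftrightarrow> \<lceil>w * real n\<rceil> \<le> z - x" by (rule ceiling_le_iff[symmetric])
          finally show ?thesis by (auto simp: y_def)
        qed
        then show ?thesis by auto
      qed
      have "measure (walk_pmf \<omega> x n) {z. y \<le> z} \<le> exp (- (d / L * (sum ?b {x..<y} - real n)))"
      proof (rule walk_upper_tail[OF d])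
        show "0 \<le> d / L" using d L by simp
        show "d / L * ?b z \<le> d" for z
        proof -
          have "d * ?b z \<le> d * L"
            using crossing_le_power[OF \<open>0 \<le> \<kappa>\<close> \<omega>, where J=J and x=z] d by (intro mult_left_mono) (auto simp: L_def)
          then show ?thesis using L by (simp add: field_simps)
        qed
        show "?b z \<le> (1 - d) / (1 + d) * (1 / \<omega> z + rho \<omega> z * ?b (z - 1))" for z
          using crossing_le_Suc[OF \<open>0 \<le> \<kappa>\<close> \<omega>01, where J=J and x=z] by (simp add: \<kappa>)
        show "- I * h \<le> x - int n" "x + int n \<le> I * h" using win by auto
      qed (use \<omega>01 b_nonneg y in auto)
      also have "exp (- (d / L * (sum ?b {x..<y} - real n))) \<le> exp (- (C * real n))"
      proof -
        have "\<xi> * real n + real n = \<tau> * (w * real n - 2 * (real n / real Q))"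
          by (simp add: \<xi>_def algebra_simps)
        also have "\<dots> \<le> \<tau> * of_int (y - x - 2 * h)"
          using \<tau> hn by (intro mult_left_mono) (auto simp: y_def h_def intro!: diff_mono)
        also have "\<dots> \<le> sum ?b {x..<y}"
          by (rule sum_ge_blocks[where I=I]) (use h b_nonneg \<tau> blocks win y in \<open>auto simp: h_def\<close>)
        finally have "d / L * (\<xi> * real n) \<le> d / L * (sum ?b {x..<y} - real n)"
          using d L by (intro mult_left_mono) auto
        then show ?thesis unfolding exp_le_cancel_iff neg_le_iff_le by (simp add: C_def)
      qed
      finally show "measure (walk_pmf \<omega> x n) {z. of_int x + w * real n \<le> of_int z} \<le> exp (- (C * real n))"
        unfolding set_eq by simp
    qed
  qed
  with \<open>0 < C\<close> show ?thesis by blast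
qed

text \<open>Union bound over the \<open>2 * W * n + 1\<close> starting points and
  \<open>n ^ g\<close> labels, followed by the first Borel-Cantelli lemma. Here \<open>D\<close> is
  the good event and \<open>r\<close> bounds the failure probability of a single chain.\<close>

lemma quenched_eventually_le:
  fixes r :: "nat \<Rightarrow> real" and D :: "int \<Rightarrow> nat \<Rightarrow> int \<Rightarrow> bool"
  assumes bound: "\<forall>\<^sub>F n in sequentially. \<forall>x. \<bar>x\<bar> \<le> int W * int n \<longrightarrow>
      measure (walk_pmf \<omega> x n) {z. \<not> D x n z} \<le> r n"
    and summable: "summable (\<lambda>n. (2 * real W * real n + 1) * (real n ^ g * r n))"
  shows "AE X in quenched \<omega>. \<forall>\<^sub>F n in sequentially. \<forall>x i. \<bar>x\<bar> \<le> int W * int n \<longrightarrow>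
    1 \<le> i \<longrightarrow> i \<le> n ^ g \<longrightarrow> D x n (X (x, i) n)"
proof -
  interpret prob_space "quenched \<omega>" by (rule prob_space_quenched)
  let ?T = "\<lambda>n. {- (int W * int n)..int W * int n} \<times> {1..n ^ g}"
  define E where "E n x i = {X \<in> space (quenched \<omega>). X (x, i) n \<in> {z. \<not> D x n z}}" for n x and i :: nat
  define A where "A n = (\<Union>(x, i)\<in>?T n. E n x i)" for n
  have E_sets: "E n x i \<in> sets (quenched \<omega>)" if "1 \<le> i" for n x i
  proof -
    have "(\<lambda>X. X (x, i)) \<in> quenched \<omega> \<rightarrow>\<^sub>M walk_law \<omega> x"
      unfolding quenched_def
      using measurable_component_singleton[of "(x, i)" "UNIV \<times> {1..}" "\<lambda>(x, i). walk_law \<omega> x"] that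
      by simp
    then have "(\<lambda>X. X (x, i) n) \<in> quenched \<omega> \<rightarrow>\<^sub>M count_space UNIV"
      by (rule measurable_compose[OF _ measurable_position])
    then show ?thesis
      unfolding E_def by measurable
  qed
  have E_prob: "prob (E n x i) = measure (walk_pmf \<omega> x n) {z. \<not> D x n z}" if "1 \<le> i" for n x i
    using emeasure_quenched_position[OF that, of \<omega> x n "{z. \<not> D x n z}"]
    by (simp add: E_def measure_def)
  have A_sets: "A n \<in> sets (quenched \<omega>)" for n
    unfolding A_def using E_sets by (intro sets.finite_UN) auto
  have "\<forall>\<^sub>F n in sequentially. norm (prob (A n)) \<le> (2 * real W * real n + 1) * (real n ^ g * r n)"
    using bound
  proof eventually_elim
    case (elim n)
    have "prob (A n) \<le> (\<Sum>(x, i)\<in>?T n. prob (E n x i))"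
      unfolding A_def split_beta
      using E_sets by (intro finite_measure_subadditive_finite) auto
    also have "\<dots> \<le> (\<Sum>(x, i)\<in>?T n. r n)"
      using elim E_prob by (intro sum_mono) auto
    also have "\<dots> = real (card (?T n)) * r n" by simp
    also have "real (card (?T n)) = (2 * real W * real n + 1) * real n ^ g"
      by (simp add: card_cartesian_product nat_add_distrib nat_mult_distrib algebra_simps)
    finally show ?case by (simp add: mult.assoc)
  qed
  then have "summable (\<lambda>n. prob (A n))"
    by (rule summable_comparison_test_ev[OF _ summable])
  then have "AE X in quenched \<omega>. \<forall>\<^sub>F n in sequentially. X \<in> space (quenched \<omega>) - A n"
    by (intro borel_cantelli_AE1 A_sets) (auto simp: emeasure_eq_measure)
  then show ?thesis
  proof eventually_elim
    case (elim X)
    then show ?case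
      by eventually_elim (auto simp: A_def E_def abs_le_iff)
  qed
qed


section \<open>Random environments\<close>

lemma (in prob_space) AE_eventually_not_mem:
  assumes "\<And>m. A m \<in> events" "\<And>m. prob (A m) \<le> f m" "summable f"
  shows "AE \<omega> in M. \<forall>\<^sub>F m in sequentially. \<omega> \<notin> A m"
proof -
  have "summable (\<lambda>m. prob (A m))"
    by (rule summable_comparison_test'[OF assms(3), of 0]) (simp add: assms(2))
  then have "AE \<omega> in M. \<forall>\<^sub>F m in sequentially. \<omega> \<in> space M - A m"
    using assms(1) by (intro borel_cantelli_AE1) (auto simp: emeasure_eq_measure)
  then show ?thesis
    by eventually_elim (auto elim: eventually_mono)
qed

text \<open>Measurability is with respect to the coordinates in \<open>S\<close> alone, since the
  recursion reads only the \<open>J\<close> sites of \<open>(x - J, x]\<close>. With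
  \<open>crossing_cong\<close>, this finite range yields independence of crossing times at distance
  at least \<open>J\<close>.\<close>

lemma crossing_measurable:
  assumes "{x - int J<..x} \<subseteq> S"
  shows "(\<lambda>\<omega>. crossing \<kappa> \<omega> J x) \<in> borel_measurable (PiM S (\<lambda>_. borel))"
  using assms
proof (induction J arbitrary: x)
  case (Suc J)
  have "{x - 1 - int J<..x - 1} \<subseteq> {x - int (Suc J)<..x}" by auto
  with Suc.prems have "{x - 1 - int J<..x - 1} \<subseteq> S" by blast
  note [measurable] = Suc.IH[OF this]
  have "x \<in> S" using Suc.prems by auto
  then have [measurable]: "(\<lambda>\<omega>. \<omega> x) \<in> borel_measurable (PiM S (\<lambda>_. borel))"
    by (rule measurable_component_singleton)
  show ?case unfolding crossing.simps rho_def by measurable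
qed simp

lemma crossing_cong:
  assumes "\<And>y. y \<in> {x - int J<..x} \<Longrightarrow> \<omega> y = \<omega>' y"
  shows "crossing \<kappa> \<omega> J x = crossing \<kappa> \<omega>' J x"
  using assms
proof (induction J arbitrary: x)
  case (Suc J)
  have "\<omega> x = \<omega>' x" using Suc.prems by simp
  moreover have "crossing \<kappa> \<omega> J (x - 1) = crossing \<kappa> \<omega>' J (x - 1)"
    using Suc.prems by (intro Suc.IH) auto
  ultimately show ?case by (simp add: rho_def)
qed simp

section \<open>Consequences of the i.i.d. and ellipticity assumptions\<close>

locale iid_environment = prob_space P for P :: "(int \<Rightarrow> real) measure" +
  fixes c :: real
  assumes sets_P: "sets P = sets environments"
    and indep: "indep_vars (\<lambda>_. borel) (\<lambda>x \<omega>. \<omega> x) (UNIV :: int set)"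
    and ident: "\<And>x. distr P borel (\<lambda>\<omega>. \<omega> x) = distr P borel (\<lambda>\<omega>. \<omega> 0)"
    and c_pos: "c > 0"
    and elliptic_0: "prob {\<omega> \<in> space P. \<omega> 0 \<in> {c..1 - c}} = 1"
    and mean_rho: "(\<integral>\<omega>. rho \<omega> 0 \<partial>P) < 1"
begin

lemma coordinate_measurable [measurable]: "(\<lambda>\<omega>. \<omega> x) \<in> borel_measurable P"
  using measurable_coordinate[of x] sets_P by (simp cong: measurable_cong_sets)

lemma crossing_measurable_P [measurable]: "(\<lambda>\<omega>. crossing \<kappa> \<omega> J x) \<in> borel_measurable P"
  by (induction J arbitrary: x) (auto simp: rho_def)

text \<open>Ellipticity at 0 moves to every site through the common marginal law, and to all sites
  at once by countability.\<close>

lemma AE_elliptic: "AE \<omega> in P. \<forall>x. \<omega> x \<in> {c..1 - c}"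
proof -
  have "AE \<omega> in P. \<omega> x \<in> {c..1 - c}" for x
  proof -
    have "AE \<omega> in P. \<omega> \<in> {\<omega> \<in> space P. \<omega> 0 \<in> {c..1 - c}}"
      by (rule AE_prob_1[OF elliptic_0])
    then have "AE \<omega> in P. \<omega> 0 \<in> {c..1 - c}" by auto
    then have "AE w in distr P borel (\<lambda>\<omega>. \<omega> 0). w \<in> {c..1 - c}"
      by (subst AE_distr_iff) auto
    then have "AE w in distr P borel (\<lambda>\<omega>. \<omega> x). w \<in> {c..1 - c}"
      by (simp only: ident[of x])
    then show ?thesis
      by (subst (asm) AE_distr_iff) auto
  qed
  then show ?thesis by (subst AE_all_countable) auto
qed

lemma AE_unit: "AE \<omega> in P. \<forall>x. 0 < \<omega> x \<and> \<omega> x \<le> 1"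
  using AE_elliptic
proof eventually_elim
  case (elim \<omega>)
  show ?case
  proof
    fix x show "0 < \<omega> x \<and> \<omega> x \<le> 1" using elim[THEN spec, of x] c_pos by auto
  qed
qed

definition \<mu> :: real where "\<mu> = (\<integral>\<omega>. rho \<omega> 0 \<partial>P)"

lemma integrable_rho [simp]: "integrable P (\<lambda>\<omega>. rho \<omega> x)"
proof (rule integrable_const_bound)
  show "AE \<omega> in P. norm (rho \<omega> x) \<le> 1 / c"
    using AE_elliptic
  proof eventually_elim
    case (elim \<omega>)
    then have "c \<le> \<omega> x" "\<omega> x \<le> 1 - c" by auto
    then show ?case
      using c_pos by (auto simp: rho_def intro!: frac_le)
  qed
qed (simp add: rho_def)

lemma expectation_rho: "expectation (\<lambda>\<omega>. rho \<omega> x) = \<mu>"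
proof -
  have "expectation (\<lambda>\<omega>. (1 - \<omega> x) / \<omega> x) = (\<integral>w. (1 - w) / w \<partial>distr P borel (\<lambda>\<omega>. \<omega> x))"
    by (subst integral_distr) auto
  also have "\<dots> = (\<integral>w. (1 - w) / w \<partial>distr P borel (\<lambda>\<omega>. \<omega> 0))"
    by (simp only: ident[of x])
  also have "\<dots> = expectation (\<lambda>\<omega>. (1 - \<omega> 0) / \<omega> 0)"
    by (subst integral_distr) auto
  finally show ?thesis by (simp add: rho_def \<mu>_def)
qed

lemma \<mu>_nonneg: "0 \<le> \<mu>"
  unfolding \<mu>_def
proof (rule integral_nonneg_AE)
  show "AE \<omega> in P. 0 \<le> rho \<omega> 0"
    using AE_unit by eventually_elim (simp add: rho_nonneg)
qed

lemma \<mu>_less_1: "\<mu> < 1"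
  using mean_rho by (simp add: \<mu>_def)

lemma AE_inverse_coordinate: "AE \<omega> in P. 1 / \<omega> x = 1 + rho \<omega> x"
  using AE_unit
proof eventually_elim
  case (elim \<omega>)
  then have "0 < \<omega> x" by auto
  then show ?case by (simp add: rho_def field_simps)
qed

text \<open>Restrictions of the environment to disjoint sets of sites are independent. Writing the
  factors through \<open>restrict\<close> records that each reads its own sites only.\<close>

lemma expectation_mult_disjoint:
  fixes f g :: "(int \<Rightarrow> real) \<Rightarrow> real"
  assumes "S \<inter> T = {}"
    and f: "f \<in> borel_measurable (PiM S (\<lambda>_. borel))" "integrable P (\<lambda>\<omega>. f (restrict \<omega> S))"
    and g: "g \<in> borel_measurable (PiM T (\<lambda>_. borel))" "integrable P (\<lambda>\<omega>. g (restrict \<omega> T))"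
  shows "expectation (\<lambda>\<omega>. f (restrict \<omega> S) * g (restrict \<omega> T)) =
    expectation (\<lambda>\<omega>. f (restrict \<omega> S)) * expectation (\<lambda>\<omega>. g (restrict \<omega> T))"
proof -
  have "indep_var (PiM S (\<lambda>_. borel)) (\<lambda>\<omega>. restrict (\<lambda>i. \<omega> i) S) (PiM T (\<lambda>_. borel)) (\<lambda>\<omega>. restrict (\<lambda>i. \<omega> i) T)"
    using assms(1) by (intro indep_var_restrict[OF indep]) auto
  from indep_var_compose[OF this f(1) g(1)]
  show ?thesis
    using f(2) g(2) by (intro indep_var_lebesgue_integral) (simp_all add: comp_def)
qed

section \<open>Moments of truncated crossing times\<close>

definition bound :: "real \<Rightarrow> nat \<Rightarrow> real" where
  "bound \<kappa> J = (1 + 2 * \<kappa> / c) ^ J"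

lemma AE_crossing_bounds:
  assumes "0 \<le> \<kappa>"
  shows "AE \<omega> in P. \<forall>J x. 0 \<le> crossing \<kappa> \<omega> J x \<and> crossing \<kappa> \<omega> J x \<le> bound \<kappa> J"
  using AE_elliptic AE_unit
proof eventually_elim
  case (elim \<omega>)
  then show ?case
    unfolding bound_def
    using crossing_le_power[OF assms c_pos] crossing_nonneg[OF assms] by blast
qed

lemma integrable_crossing:
  assumes "0 \<le> \<kappa>"
  shows "integrable P (\<lambda>\<omega>. crossing \<kappa> \<omega> J x)"
proof (rule integrable_const_bound)
  show "AE \<omega> in P. norm (crossing \<kappa> \<omega> J x) \<le> bound \<kappa> J"
    using AE_crossing_bounds[OF assms] by eventually_elim simp
qed simp

text \<open>The fixed point of \<open>e = \<kappa> * (1 + \<mu> + \<mu> * e)\<close>, that is, the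
  mean of the untruncated crossing time when \<open>\<kappa> * \<mu> < 1\<close>.\<close>

definition mean_crossing :: "real \<Rightarrow> real" where
  "mean_crossing \<kappa> = \<kappa> * (1 + \<mu>) / (1 - \<kappa> * \<mu>)"

text \<open>Since \<open>1 / \<omega> x = 1 + rho \<omega> x\<close> almost surely, and
  \<open>rho \<omega> x\<close> is independent of the crossing time at \<open>x - 1\<close>, which
  reads only sites left of \<open>x\<close>, the means obey a scalar affine recursion. The distance
  to its fixed point shrinks by the factor \<open>\<kappa> * \<mu>\<close> per level.\<close>

lemma expectation_crossing:
  assumes "0 \<le> \<kappa>" "\<kappa> * \<mu> < 1"
  shows "expectation (\<lambda>\<omega>. crossing \<kappa> \<omega> J x) = mean_crossing \<kappa> * (1 - (\<kappa> * \<mu>) ^ J)"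
proof (induction J arbitrary: x)
  case (Suc J)
  define S T where "S = {x}" and "T = {x - 1 - int J<..x - 1}"
  have restrict: "rho \<omega> x = rho (restrict \<omega> S) x"
      "crossing \<kappa> \<omega> J (x - 1) = crossing \<kappa> (restrict \<omega> T) J (x - 1)" for \<omega>
    by (auto simp: rho_def S_def T_def intro!: crossing_cong)
  have "expectation (\<lambda>\<omega>. rho (restrict \<omega> S) x * crossing \<kappa> (restrict \<omega> T) J (x - 1)) =
      expectation (\<lambda>\<omega>. rho (restrict \<omega> S) x) * expectation (\<lambda>\<omega>. crossing \<kappa> (restrict \<omega> T) J (x - 1))"
  proof (rule expectation_mult_disjoint)
    have [measurable]: "(\<lambda>\<omega>. \<omega> x) \<in> borel_measurable (PiM S (\<lambda>_. borel))"
      by (rule measurable_component_singleton) (simp add: S_def)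
    show "(\<lambda>\<omega>. rho \<omega> x) \<in> borel_measurable (PiM S (\<lambda>_. borel))"
      unfolding rho_def by measurable
    show "(\<lambda>\<omega>. crossing \<kappa> \<omega> J (x - 1)) \<in> borel_measurable (PiM T (\<lambda>_. borel))"
      by (rule crossing_measurable) (simp add: T_def)
    show "S \<inter> T = {}" by (auto simp: S_def T_def)
    show "integrable P (\<lambda>\<omega>. rho (restrict \<omega> S) x)"
      "integrable P (\<lambda>\<omega>. crossing \<kappa> (restrict \<omega> T) J (x - 1))"
      using integrable_rho[of x] integrable_crossing[OF assms(1), of J "x - 1"] by (simp_all add: restrict[symmetric])
  qed
  then have prod: "expectation (\<lambda>\<omega>. rho \<omega> x * crossing \<kappa> \<omega> J (x - 1)) =
      \<mu> * (mean_crossing \<kappa> * (1 - (\<kappa> * \<mu>) ^ J))"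
    using Suc.IH[of "x - 1"] expectation_rho[of x] by (simp add: restrict[symmetric])
  have int: "integrable P (\<lambda>\<omega>. rho \<omega> x * crossing \<kappa> \<omega> J (x - 1))"
  proof (rule Bochner_Integration.integrable_bound)
    show "integrable P (\<lambda>\<omega>. rho \<omega> x * bound \<kappa> J)" by simp
    show "AE \<omega> in P. norm (rho \<omega> x * crossing \<kappa> \<omega> J (x - 1)) \<le> norm (rho \<omega> x * bound \<kappa> J)"
      using AE_crossing_bounds[OF assms(1)]
    proof eventually_elim
      case (elim \<omega>)
      then have "\<bar>crossing \<kappa> \<omega> J (x - 1)\<bar> \<le> \<bar>bound \<kappa> J\<bar>"
        by (metis abs_of_nonneg order_trans)
      then show ?case by (simp add: abs_mult mult_left_mono)
    qed
  qed (simp add: rho_def)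
  have "expectation (\<lambda>\<omega>. crossing \<kappa> \<omega> (Suc J) x) =
      expectation (\<lambda>\<omega>. \<kappa> * (1 + rho \<omega> x + rho \<omega> x * crossing \<kappa> \<omega> J (x - 1)))"
  proof (rule integral_cong_AE)
    show "AE \<omega> in P. crossing \<kappa> \<omega> (Suc J) x = \<kappa> * (1 + rho \<omega> x + rho \<omega> x * crossing \<kappa> \<omega> J (x - 1))"
      using AE_inverse_coordinate[of x] by eventually_elim simp
  qed (auto simp: rho_def)
  also have "\<dots> = \<kappa> * (1 + \<mu> + \<mu> * (mean_crossing \<kappa> * (1 - (\<kappa> * \<mu>) ^ J)))"
    using int prod by (simp add: expectation_rho prob_space)
  also have "\<dots> = mean_crossing \<kappa> * (1 - (\<kappa> * \<mu>) ^ Suc J)"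
  proof -
    have "\<kappa> * (1 + \<mu>) = mean_crossing \<kappa> * (1 - \<kappa> * \<mu>)"
      using assms(2) by (simp add: mean_crossing_def)
    then show ?thesis by (simp add: algebra_simps)
  qed
  finally show ?case .
qed simp

text \<open>At this distance the ranges \<open>(k - J, k]\<close> and \<open>(l - J, l]\<close> read
  by the two crossing times are disjoint.\<close>

lemma covariance_crossing:
  assumes "0 \<le> \<kappa>" "int J \<le> \<bar>k - l\<bar>"
  shows "expectation (\<lambda>\<omega>. (crossing \<kappa> \<omega> J k - m) * (crossing \<kappa> \<omega> J l - m)) =
    expectation (\<lambda>\<omega>. crossing \<kappa> \<omega> J k - m) * expectation (\<lambda>\<omega>. crossing \<kappa> \<omega> J l - m)"
proof -
  define S T where "S = {k - int J<..k}" and "T = {l - int J<..l}"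
  have restrict: "crossing \<kappa> (restrict \<omega> S) J k = crossing \<kappa> \<omega> J k"
      "crossing \<kappa> (restrict \<omega> T) J l = crossing \<kappa> \<omega> J l" for \<omega>
    by (rule crossing_cong, simp add: S_def T_def)+
  have "expectation (\<lambda>\<omega>. (crossing \<kappa> (restrict \<omega> S) J k - m) * (crossing \<kappa> (restrict \<omega> T) J l - m)) =
    expectation (\<lambda>\<omega>. crossing \<kappa> (restrict \<omega> S) J k - m) * expectation (\<lambda>\<omega>. crossing \<kappa> (restrict \<omega> T) J l - m)"
  proof (rule expectation_mult_disjoint)
    show "S \<inter> T = {}" using assms(2) by (auto simp: S_def T_def)
    show "(\<lambda>\<omega>. crossing \<kappa> \<omega> J k - m) \<in> borel_measurable (PiM S (\<lambda>_. borel))"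
      "(\<lambda>\<omega>. crossing \<kappa> \<omega> J l - m) \<in> borel_measurable (PiM T (\<lambda>_. borel))"
      by (auto intro!: borel_measurable_diff crossing_measurable simp: S_def T_def)
    show "integrable P (\<lambda>\<omega>. crossing \<kappa> (restrict \<omega> S) J k - m)"
      "integrable P (\<lambda>\<omega>. crossing \<kappa> (restrict \<omega> T) J l - m)"
      unfolding restrict by (simp_all add: integrable_crossing assms(1))
  qed
  then show ?thesis by (simp add: restrict)
qed

text \<open>After centring, pairs of sites at distance at least \<open>J\<close> contribute nothing.
  For each \<open>k\<close> at most \<open>2 * J\<close> sites remain, and each contributes at most
  the square of \<open>bound \<kappa> J\<close>.\<close>

lemma second_moment_crossing:
  fixes B :: "int set" and J :: nat
  assumes \<kappa>: "0 \<le> \<kappa>" "\<kappa> * \<mu> < 1" and "finite B"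
  defines "m \<equiv> mean_crossing \<kappa> * (1 - (\<kappa> * \<mu>) ^ J)"
  shows "integrable P (\<lambda>\<omega>. (\<Sum>k\<in>B. crossing \<kappa> \<omega> J k - m)\<^sup>2)"
    and "expectation (\<lambda>\<omega>. (\<Sum>k\<in>B. crossing \<kappa> \<omega> J k - m)\<^sup>2) \<le> real (card B) * (2 * real J) * (bound \<kappa> J)\<^sup>2"
proof -
  define Y where "Y k \<omega> = crossing \<kappa> \<omega> J k - m" for k \<omega>
  let ?M = "bound \<kappa> J"
  have Y_meas [measurable]: "Y k \<in> borel_measurable P" for k
    unfolding Y_def by measurable
  have m: "expectation (\<lambda>\<omega>. crossing \<kappa> \<omega> J k) = m" for k
    unfolding m_def by (rule expectation_crossing[OF \<kappa>])
  have "0 \<le> m"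
    unfolding m[symmetric, of 0] using AE_crossing_bounds[OF \<kappa>(1)]
    by (intro integral_nonneg_AE) (auto elim: eventually_mono)
  have "m \<le> ?M"
  proof -
    have "AE \<omega> in P. crossing \<kappa> \<omega> J 0 \<le> ?M"
      using AE_crossing_bounds[OF \<kappa>(1)] by eventually_elim simp
    then have "expectation (\<lambda>\<omega>. crossing \<kappa> \<omega> J 0) \<le> expectation (\<lambda>\<omega>. ?M)"
      by (intro integral_mono_AE integrable_crossing \<kappa>) auto
    then show ?thesis by (simp add: m prob_space)
  qed
  have Y_bound: "AE \<omega> in P. \<forall>k. \<bar>Y k \<omega>\<bar> \<le> ?M"
    using AE_crossing_bounds[OF \<kappa>(1)]
  proof eventually_elim
    case (elim \<omega>)
    show ?case
    proof
      fix k
      have "0 \<le> crossing \<kappa> \<omega> J k" "crossing \<kappa> \<omega> J k \<le> ?M" using elim by auto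
      then show "\<bar>Y k \<omega>\<bar> \<le> ?M" using \<open>0 \<le> m\<close> \<open>m \<le> ?M\<close> by (auto simp: Y_def)
    qed
  qed
  have YY_bound: "AE \<omega> in P. \<bar>Y k \<omega> * Y l \<omega>\<bar> \<le> ?M\<^sup>2" for k l
    using Y_bound
  proof eventually_elim
    case (elim \<omega>)
    then show ?case
      unfolding abs_mult power2_eq_square by (intro mult_mono) (auto intro: order_trans[OF abs_ge_zero])
  qed
  have YY_int: "integrable P (\<lambda>\<omega>. Y k \<omega> * Y l \<omega>)" for k l
    by (rule integrable_const_bound[where B="?M\<^sup>2"]) (use YY_bound in auto)
  have sq: "(\<Sum>k\<in>B. Y k \<omega>)\<^sup>2 = (\<Sum>k\<in>B. \<Sum>l\<in>B. Y k \<omega> * Y l \<omega>)" for \<omega>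
    by (simp add: power2_eq_square sum_product)
  show "integrable P (\<lambda>\<omega>. (\<Sum>k\<in>B. crossing \<kappa> \<omega> J k - m)\<^sup>2)"
    unfolding Y_def[symmetric] sq by (intro Bochner_Integration.integrable_sum YY_int)
  have cov: "expectation (\<lambda>\<omega>. Y k \<omega> * Y l \<omega>) \<le> (if l \<in> {k - int J<..<k + int J} then ?M\<^sup>2 else 0)" for k l
  proof (cases "l \<in> {k - int J<..<k + int J}")
    case True
    have "AE \<omega> in P. Y k \<omega> * Y l \<omega> \<le> ?M\<^sup>2"
      using YY_bound[of k l] by eventually_elim simp
    then have "expectation (\<lambda>\<omega>. Y k \<omega> * Y l \<omega>) \<le> expectation (\<lambda>\<omega>. ?M\<^sup>2)"
      by (intro integral_mono_AE YY_int) auto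
    with True show ?thesis by (simp add: prob_space)
  next
    case False
    then have "expectation (\<lambda>\<omega>. Y k \<omega> * Y l \<omega>) = expectation (Y k) * expectation (Y l)"
      unfolding Y_def by (intro covariance_crossing \<kappa>) auto
    also have "expectation (Y k) = 0"
      unfolding Y_def using integrable_crossing[OF \<kappa>(1)] by (simp add: m prob_space)
    finally show ?thesis using False by simp
  qed
  have "expectation (\<lambda>\<omega>. (\<Sum>k\<in>B. Y k \<omega>)\<^sup>2) = (\<Sum>k\<in>B. \<Sum>l\<in>B. expectation (\<lambda>\<omega>. Y k \<omega> * Y l \<omega>))"
    unfolding sq using YY_int by (simp add: Bochner_Integration.integral_sum)
  also have "\<dots> \<le> (\<Sum>k\<in>B. \<Sum>l\<in>B. if l \<in> {k - int J<..<k + int J} then ?M\<^sup>2 else 0)"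
    by (intro sum_mono cov)
  also have "\<dots> \<le> (\<Sum>k\<in>B. 2 * real J * ?M\<^sup>2)"
  proof (rule sum_mono)
    fix k
    have "(\<Sum>l\<in>B. if l \<in> {k - int J<..<k + int J} then ?M\<^sup>2 else 0) =
        real (card (B \<inter> {k - int J<..<k + int J})) * ?M\<^sup>2"
      using \<open>finite B\<close> by (simp only: sum.If_cases Collect_mem_eq) simp
    also have "\<dots> \<le> 2 * real J * ?M\<^sup>2"
    proof (rule mult_right_mono)
      have "card (B \<inter> {k - int J<..<k + int J}) \<le> card {k - int J<..<k + int J}"
        by (intro card_mono) auto
      also have "\<dots> \<le> 2 * J" by simp
      finally show "real (card (B \<inter> {k - int J<..<k + int J})) \<le> 2 * real J" by linarith
    qed simp
    finally show "(\<Sum>l\<in>B. if l \<in> {k - int J<..<k + int J} then ?M\<^sup>2 else 0) \<le> 2 * real J * ?M\<^sup>2" .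
  qed
  finally show "expectation (\<lambda>\<omega>. (\<Sum>k\<in>B. crossing \<kappa> \<omega> J k - m)\<^sup>2) \<le> real (card B) * (2 * real J) * (bound \<kappa> J)\<^sup>2"
    by (simp add: Y_def mult.assoc)
qed

text \<open>Chebyshev's inequality on each block of length \<open>2 ^ m\<close>, a union over a
  number of blocks independent of \<open>m\<close>, and Borel-Cantelli over the scales. The level
  \<open>j\<close> may grow with \<open>m\<close> as long as the variance bounds stay
  summable.\<close>

lemma AE_block_concentration:
  fixes I :: int and j :: "nat \<Rightarrow> nat"
  assumes \<kappa>: "0 \<le> \<kappa>" "\<kappa> * \<mu> < 1" and "0 < \<eta>"
    and summable: "summable (\<lambda>m. 2 * real (j m) * (bound \<kappa> (j m))\<^sup>2 / 2 ^ m)"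
  shows "AE \<omega> in P. \<forall>\<^sub>F m in sequentially. \<forall>i. - I \<le> i \<longrightarrow> i < I \<longrightarrow>
    \<bar>sum (crossing \<kappa> \<omega> (j m)) {i * 2 ^ m..<(i + 1) * 2 ^ m} -
      mean_crossing \<kappa> * (1 - (\<kappa> * \<mu>) ^ j m) * 2 ^ m\<bar> < \<eta> * 2 ^ m"
proof -
  define Z where "Z m i \<omega> = (\<Sum>k\<in>{i * 2 ^ m..<(i + 1) * 2 ^ m}.
      crossing \<kappa> \<omega> (j m) k - mean_crossing \<kappa> * (1 - (\<kappa> * \<mu>) ^ j m))" for m i \<omega>
  define A where "A m = (\<Union>i\<in>{- I..<I}. {\<omega> \<in> space P. \<bar>Z m i \<omega>\<bar> \<ge> \<eta> * 2 ^ m})" for m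
  define s where "s m = 2 * real (j m) * (bound \<kappa> (j m))\<^sup>2 / 2 ^ m" for m
  have card: "card {i * 2 ^ m..<(i + 1) * 2 ^ m} = (2 :: nat) ^ m" for i :: int and m
  proof -
    have "(i + 1) * 2 ^ m - i * 2 ^ m = int (2 ^ m)" by (simp add: algebra_simps)
    then show ?thesis by (simp only: card_atLeastLessThan_int nat_int)
  qed
  have Z_meas [measurable]: "Z m i \<in> borel_measurable P" for m i
    unfolding Z_def by measurable
  have Z_prob: "prob {\<omega> \<in> space P. \<bar>Z m i \<omega>\<bar> \<ge> \<eta> * 2 ^ m} \<le> s m / \<eta>\<^sup>2" for m i
  proof -
    have "prob {\<omega> \<in> space P. \<bar>Z m i \<omega>\<bar> \<ge> \<eta> * 2 ^ m} \<le> expectation (\<lambda>\<omega>. (Z m i \<omega>)\<^sup>2) / (\<eta> * 2 ^ m)\<^sup>2"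
      unfolding Z_def using \<open>0 < \<eta>\<close>
      by (intro second_moment_method second_moment_crossing(1) \<kappa>) auto
    also have "\<dots> \<le> (2 ^ m * (2 * real (j m)) * (bound \<kappa> (j m))\<^sup>2) / (\<eta> * 2 ^ m)\<^sup>2"
      unfolding Z_def
      using second_moment_crossing(2)[OF \<kappa>, of "{i * 2 ^ m..<(i + 1) * 2 ^ m}" "j m"]
      by (intro divide_right_mono) (simp_all add: card del: card_atLeastLessThan_int)
    also have "\<dots> = s m / \<eta>\<^sup>2"
      by (simp add: s_def power2_eq_square mult_ac)
    finally show ?thesis .
  qed
  have "prob (A m) \<le> real (card {- I..<I}) * (s m / \<eta>\<^sup>2)" for m
  proof -
    have "prob (A m) \<le> (\<Sum>i\<in>{- I..<I}. prob {\<omega> \<in> space P. \<bar>Z m i \<omega>\<bar> \<ge> \<eta> * 2 ^ m})"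
      unfolding A_def by (intro finite_measure_subadditive_finite) auto
    also have "\<dots> \<le> (\<Sum>i\<in>{- I..<I}. s m / \<eta>\<^sup>2)"
      by (intro sum_mono Z_prob)
    finally show ?thesis by simp
  qed
  moreover have "A m \<in> events" for m
    unfolding A_def by (intro sets.finite_UN) auto
  moreover have "summable (\<lambda>m. real (card {- I..<I}) * (s m / \<eta>\<^sup>2))"
    using summable unfolding s_def by (intro summable_mult summable_divide)
  ultimately have "AE \<omega> in P. \<forall>\<^sub>F m in sequentially. \<omega> \<notin> A m"
    by (intro AE_eventually_not_mem)
  with AE_space show ?thesis
  proof eventually_elim
    case (elim \<omega>)
    from elim(2) show ?case
    proof eventually_elim
      case (elim m)
      have "sum (crossing \<kappa> \<omega> (j m)) {i * 2 ^ m..<(i + 1) * 2 ^ m} -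
          mean_crossing \<kappa> * (1 - (\<kappa> * \<mu>) ^ j m) * 2 ^ m = Z m i \<omega>" for i
        by (simp add: Z_def sum_subtractf card del: card_atLeastLessThan_int)
      with elim \<open>\<omega> \<in> space P\<close> show ?case
        by (auto simp: A_def not_le)
    qed
  qed
qed

lemma AE_fast_blocks:
  fixes I :: int and J :: nat
  assumes \<kappa>: "0 \<le> \<kappa>" "\<kappa> * \<mu> < 1" and "0 < \<eta>"
  shows "AE \<omega> in P. \<forall>\<^sub>F m in sequentially. \<forall>i. - I \<le> i \<longrightarrow> i < I \<longrightarrow>
    (mean_crossing \<kappa> * (1 - (\<kappa> * \<mu>) ^ J) - \<eta>) * 2 ^ m \<le>
      sum (crossing \<kappa> \<omega> J) {i * 2 ^ m..<(i + 1) * 2 ^ m}"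
proof -
  have "summable (\<lambda>m. 2 * real J * (bound \<kappa> J)\<^sup>2 * (1 / 2) ^ m)"
    by (intro summable_mult summable_geometric) simp
  then have "summable (\<lambda>m. 2 * real J * (bound \<kappa> J)\<^sup>2 / 2 ^ m)"
    by (simp add: power_one_over field_simps)
  from AE_block_concentration[OF \<kappa> \<open>0 < \<eta>\<close> this, of I]
  show ?thesis
  proof eventually_elim
    case (elim \<omega>)
    then show ?case
    proof eventually_elim
      case (elim m)
      show ?case
      proof (intro allI impI)
        fix i assume "- I \<le> i" "i < I"
        with elim show "(mean_crossing \<kappa> * (1 - (\<kappa> * \<mu>) ^ J) - \<eta>) * 2 ^ m \<le>
            sum (crossing \<kappa> \<omega> J) {i * 2 ^ m..<(i + 1) * 2 ^ m}"
          unfolding left_diff_distrib by (smt (verit))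
      qed
    qed
  qed
qed

section \<open>Crossing times of growing order\<close>

lemma mean_crossing_nonneg:
  assumes "0 \<le> \<kappa>" "\<kappa> * \<mu> < 1"
  shows "0 \<le> mean_crossing \<kappa>"
  using assms \<mu>_nonneg by (simp add: mean_crossing_def)

text \<open>The part of the crossing time of order above \<open>j m\<close> has mean at most
  \<open>mean_crossing \<kappa> * \<nu> ^ j m\<close> at each site. Markov's inequality is applied
  to its sum over the window, because \<open>\<kappa> * \<mu> < 1\<close> controls first moments but
  not second ones.\<close>

lemma AE_slow_remainder:
  fixes I :: int and j J :: "nat \<Rightarrow> nat"
  assumes \<kappa>: "0 \<le> \<kappa>" "\<kappa> * \<mu> < 1" and "0 \<le> I" and jJ: "\<And>m. j m \<le> J m"
    and \<nu>: "\<kappa> * \<mu> \<le> \<nu>" and summable: "summable (\<lambda>m. \<nu> ^ j m * (real m + 1)\<^sup>2)"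
  shows "AE \<omega> in P. \<forall>\<^sub>F m in sequentially.
    2 * (real m + 1)\<^sup>2 * (\<Sum>k\<in>{- I * 2 ^ m..<I * 2 ^ m}. crossing \<kappa> \<omega> (J m) k - crossing \<kappa> \<omega> (j m) k) < 2 ^ m"
proof -
  define R where "R m \<omega> = (\<Sum>k\<in>{- I * 2 ^ m..<I * 2 ^ m}.
      crossing \<kappa> \<omega> (J m) k - crossing \<kappa> \<omega> (j m) k)" for m \<omega>
  \<comment> \<open>Half of the budget \<open>2 ^ m / (m + 1)^2\<close> of a single crossing time;
    the other half is kept for the terms of order at most \<open>j m\<close>.\<close>
  define t where "t m = 2 ^ m / (2 * (real m + 1)\<^sup>2)" for m :: nat
  define A where "A m = {\<omega> \<in> space P. t m \<le> R m \<omega>}" for m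
  have t: "0 < t m" for m by (simp add: t_def add_pos_nonneg)
  have R_meas [measurable]: "R m \<in> borel_measurable P" for m
    unfolding R_def by measurable
  have R_int: "integrable P (R m)" for m
    unfolding R_def by (intro Bochner_Integration.integrable_sum Bochner_Integration.integrable_diff integrable_crossing \<kappa>)
  have R_nonneg: "AE \<omega> in P. 0 \<le> R m \<omega>" for m
    using AE_unit
  proof eventually_elim
    case (elim \<omega>)
    then show ?case
      unfolding R_def using crossing_mono[OF \<kappa>(1) _ jJ[of m]] by (intro sum_nonneg) auto
  qed
  have card: "real (card {- I * 2 ^ m..<I * 2 ^ m}) = 2 * of_int I * 2 ^ m" for m
    using \<open>0 \<le> I\<close> by simp
  have E: "expectation (R m) \<le> 2 * of_int I * 2 ^ m * (mean_crossing \<kappa> * \<nu> ^ j m)" for m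
  proof -
    have "expectation (R m) = (\<Sum>k\<in>{- I * 2 ^ m..<I * 2 ^ m}.
        mean_crossing \<kappa> * (1 - (\<kappa> * \<mu>) ^ J m) - mean_crossing \<kappa> * (1 - (\<kappa> * \<mu>) ^ j m))"
      unfolding R_def using integrable_crossing[OF \<kappa>(1)]
      by (simp add: Bochner_Integration.integral_sum expectation_crossing[OF \<kappa>])
    also have "\<dots> \<le> (\<Sum>k\<in>{- I * 2 ^ m..<I * 2 ^ m}. mean_crossing \<kappa> * \<nu> ^ j m)"
    proof (rule sum_mono)
      have q: "0 \<le> \<kappa> * \<mu>" using \<kappa> \<mu>_nonneg by simp
      then have "(\<kappa> * \<mu>) ^ j m - (\<kappa> * \<mu>) ^ J m \<le> \<nu> ^ j m"
        using power_mono[OF \<nu> q, of "j m"] zero_le_power[OF q, of "J m"] by linarith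
      then have "mean_crossing \<kappa> * ((\<kappa> * \<mu>) ^ j m - (\<kappa> * \<mu>) ^ J m) \<le> mean_crossing \<kappa> * \<nu> ^ j m"
        by (intro mult_left_mono mean_crossing_nonneg \<kappa>)
      then show "mean_crossing \<kappa> * (1 - (\<kappa> * \<mu>) ^ J m) - mean_crossing \<kappa> * (1 - (\<kappa> * \<mu>) ^ j m)
          \<le> mean_crossing \<kappa> * \<nu> ^ j m"
        by (simp add: algebra_simps)
    qed
    also have "\<dots> = 2 * of_int I * 2 ^ m * (mean_crossing \<kappa> * \<nu> ^ j m)"
      by (simp only: sum_constant card)
    finally show ?thesis .
  qed
  have "prob (A m) \<le> 4 * of_int I * mean_crossing \<kappa> * (\<nu> ^ j m * (real m + 1)\<^sup>2)" for m
  proof -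
    have "prob (A m) \<le> expectation (R m) / t m"
      unfolding A_def by (rule integral_Markov_inequality_measure[where A="{}"]) (use R_int R_nonneg t in auto)
    also have "\<dots> \<le> (2 * of_int I * 2 ^ m * (mean_crossing \<kappa> * \<nu> ^ j m)) / t m"
      using E[of m] t[of m] by (intro divide_right_mono) auto
    also have "\<dots> = 4 * of_int I * mean_crossing \<kappa> * (\<nu> ^ j m * (real m + 1)\<^sup>2)"
      by (simp add: t_def)
    finally show ?thesis .
  qed
  then have "AE \<omega> in P. \<forall>\<^sub>F m in sequentially. \<omega> \<notin> A m"
    by (rule AE_eventually_not_mem[rotated]) (auto simp: A_def intro!: summable_mult summable)
  with AE_space show ?thesis
  proof eventually_elim
    case (elim \<omega>)
    from elim(2) show ?case
    proof eventually_elim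
      case (elim m)
      then have "R m \<omega> < t m" using \<open>\<omega> \<in> space P\<close> by (simp add: A_def)
      then show ?case
        unfolding R_def[symmetric] t_def by (simp add: pos_less_divide_eq add_pos_nonneg mult.commute)
    qed
  qed
qed

text \<open>\<open>m div D\<close> is larger than \<open>m / D - 1\<close>, so the power decays
  exponentially in \<open>m\<close> and beats the square.\<close>

lemma summable_power_div:
  fixes \<nu> :: real
  assumes "0 < \<nu>" "\<nu> < 1" "0 < D"
  shows "summable (\<lambda>m. \<nu> ^ (m div D) * (real m + 1)\<^sup>2)"
proof -
  define b where "b = - ln \<nu> / real D"
  have b: "0 < b" using assms by (simp add: b_def divide_neg_pos)
  have le: "\<nu> ^ (m div D) \<le> exp (- b * real m + b * real D)" for m
  proof -
    have "real m = real (m div D * D + m mod D)" by simp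
    also have "\<dots> \<le> real (m div D) * real D + real D"
      using mod_less_divisor[OF \<open>0 < D\<close>, of m] unfolding of_nat_add of_nat_mult by linarith
    finally have "real m - real D \<le> real (m div D) * real D" by simp
    then have "b * (real m - real D) \<le> b * (real (m div D) * real D)"
      using b by (intro mult_left_mono) auto
    moreover have "b * (real (m div D) * real D) = - (real (m div D) * ln \<nu>)"
      using \<open>0 < D\<close> by (simp add: b_def)
    ultimately have "real (m div D) * ln \<nu> \<le> - b * real m + b * real D"
      by (simp add: algebra_simps)
    moreover have "\<nu> ^ (m div D) = exp (real (m div D) * ln \<nu>)"
      using assms(1) by (simp add: exp_of_nat_mult)
    ultimately show ?thesis by simp
  qed
  have "summable (\<lambda>m. exp (- b * real m + b * real D) * (real m + 1)\<^sup>2)"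
  proof (rule summable_comparison_test_bigo)
    show "summable (\<lambda>m. norm (inverse (real m ^ 2)))"
      using inverse_power_summable[of 2, where 'a=real] by simp
    show "(\<lambda>m. exp (- b * real m + b * real D) * (real m + 1)\<^sup>2) \<in> O(\<lambda>m. inverse (real m ^ 2))"
      using b by real_asymp
  qed
  then show ?thesis
    by (rule summable_comparison_test'[where N=0]) (use assms le in \<open>auto intro!: mult_right_mono simp: abs_mult\<close>)
qed

text \<open>Each crossing time is split at order \<open>m div D\<close>. The lower part is at most
  \<open>2 ^ (m / 2)\<close> and its block sums concentrate; the upper part is nonnegative, and its
  total over the window is small enough to be negligible at each site and in each block.\<close>

lemma AE_slow_blocks:
  fixes I :: int
  assumes \<kappa>: "0 \<le> \<kappa>" "\<kappa> * \<mu> < 1" and "0 < \<eta>" and "0 \<le> I"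
    and a: "\<And>\<omega> m k. a \<omega> m k = crossing \<kappa> \<omega> (nat (k + I * 2 ^ m + 1)) k"
  shows "AE \<omega> in P. \<forall>\<^sub>F m in sequentially.
      (\<forall>i. - I \<le> i \<longrightarrow> i < I \<longrightarrow> sum (a \<omega> m) {i * 2 ^ m..<(i + 1) * 2 ^ m} \<le> (mean_crossing \<kappa> + \<eta>) * 2 ^ m) \<and>
      (\<forall>k. - I * 2 ^ m \<le> k \<longrightarrow> k < I * 2 ^ m \<longrightarrow> (real m + 1)\<^sup>2 * a \<omega> m k \<le> 2 ^ m)"
proof -
  define L where "L = 1 + 2 * \<kappa> / c"
  have "1 \<le> L" using \<kappa> c_pos by (simp add: L_def)
  \<comment> \<open>\<open>D\<close> is so large that \<open>L ^ (4 * j m) \<le> 2 ^ m\<close>; then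
    the square of \<open>bound \<kappa> (j m)\<close> is at most \<open>2 ^ (m / 2)\<close> and the
    variance bounds are summable. Taking \<open>D = Suc D0\<close> makes \<open>D\<close>
    positive.\<close>
  obtain D0 where "L ^ 4 < 2 ^ D0" using real_arch_pow[of 2 "L ^ 4"] by auto
  define D where "D = Suc D0"
  have "0 < D" by (simp add: D_def)
  have "(2::real) ^ D0 \<le> 2 ^ D" by (simp add: D_def)
  with \<open>L ^ 4 < 2 ^ D0\<close> have D: "L ^ 4 \<le> 2 ^ D" by linarith
  define j where "j m = m div D" for m
  \<comment> \<open>The second entry is the highest level in the window, attained at its last site
    \<open>I * 2 ^ m - 1\<close>; the maximum ensures \<open>j m \<le> J m\<close>.\<close>
  define J where "J m = max (j m) (nat (2 * I * 2 ^ m))" for m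
  \<comment> \<open>\<open>\<kappa> * \<mu>\<close> may be 0; the value \<open>1 / 2\<close> keeps
    \<nu> positive, as \<open>summable_power_div\<close> requires.\<close>
  define \<nu> where "\<nu> = max (\<kappa> * \<mu>) (1 / 2)"
  have bound_sq: "(bound \<kappa> (j m))\<^sup>2 \<le> 2 powr (real m / 2)" for m
  proof -
    have "((bound \<kappa> (j m))\<^sup>2)\<^sup>2 = (L ^ 4) ^ j m"
      by (simp add: bound_def L_def power_mult[symmetric] mult.commute)
    also have "\<dots> \<le> (2 ^ D) ^ j m"
      using \<open>1 \<le> L\<close> D by (intro power_mono) auto
    also have "\<dots> = 2 ^ (D * j m)" by (simp add: power_mult)
    also have "\<dots> \<le> 2 ^ m" by (intro power_increasing) (auto simp: j_def)
    also have "\<dots> = (2 powr (real m / 2))\<^sup>2"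
      by (simp add: power2_eq_square powr_add[symmetric] powr_realpow)
    finally show ?thesis by (rule power2_le_imp_le) simp
  qed
  have bound_le: "bound \<kappa> (j m) \<le> 2 powr (real m / 2)" for m
  proof -
    have "1 \<le> bound \<kappa> (j m)" using \<open>1 \<le> L\<close> by (simp add: bound_def L_def)
    then have "bound \<kappa> (j m) \<le> (bound \<kappa> (j m))\<^sup>2" by (rule self_le_power) simp
    with bound_sq[of m] show ?thesis by linarith
  qed
  have "summable (\<lambda>m. 2 * real m * 2 powr (real m / 2) / 2 ^ m)"
  proof (rule summable_comparison_test_bigo)
    show "summable (\<lambda>m. norm (inverse (real m ^ 2)))"
      using inverse_power_summable[of 2, where 'a=real] by simp
    show "(\<lambda>m. 2 * real m * 2 powr (real m / 2) / 2 ^ m) \<in> O(\<lambda>m. inverse (real m ^ 2))"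
      by real_asymp
  qed
  then have "summable (\<lambda>m. 2 * real (j m) * (bound \<kappa> (j m))\<^sup>2 / 2 ^ m)"
  proof (rule summable_comparison_test'[where N=0])
    fix m
    have "2 * real (j m) * (bound \<kappa> (j m))\<^sup>2 \<le> 2 * real m * 2 powr (real m / 2)"
      by (intro mult_mono bound_sq) (auto simp: j_def)
    then show "norm (2 * real (j m) * (bound \<kappa> (j m))\<^sup>2 / 2 ^ m) \<le> 2 * real m * 2 powr (real m / 2) / 2 ^ m"
      by (simp add: divide_right_mono)
  qed
  moreover have "0 < \<eta> / 2" using \<open>0 < \<eta>\<close> by simp
  ultimately have conc: "AE \<omega> in P. \<forall>\<^sub>F m in sequentially. \<forall>i. - I \<le> i \<longrightarrow> i < I \<longrightarrow>
    \<bar>sum (crossing \<kappa> \<omega> (j m)) {i * 2 ^ m..<(i + 1) * 2 ^ m} -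
      mean_crossing \<kappa> * (1 - (\<kappa> * \<mu>) ^ j m) * 2 ^ m\<bar> < \<eta> / 2 * 2 ^ m"
    by (intro AE_block_concentration \<kappa>)
  have rem: "AE \<omega> in P. \<forall>\<^sub>F m in sequentially.
    2 * (real m + 1)\<^sup>2 * (\<Sum>k\<in>{- I * 2 ^ m..<I * 2 ^ m}. crossing \<kappa> \<omega> (J m) k - crossing \<kappa> \<omega> (j m) k) < 2 ^ m"
  proof (rule AE_slow_remainder[OF \<kappa> \<open>0 \<le> I\<close>, where \<nu>=\<nu>])
    show "summable (\<lambda>m. \<nu> ^ j m * (real m + 1)\<^sup>2)"
      unfolding j_def by (rule summable_power_div) (use \<kappa> \<open>0 < D\<close> in \<open>auto simp: \<nu>_def\<close>)
  qed (auto simp: J_def \<nu>_def)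
  have ev1: "\<forall>\<^sub>F m in sequentially. 2 * (real m + 1)\<^sup>2 * 2 powr (real m / 2) \<le> 2 ^ m"
    by real_asymp
  \<comment> \<open>Once this holds, a window sum of at most \<open>2 ^ m / (2 * (m + 1)^2)\<close>
    is at most \<open>\<eta> / 2 * 2 ^ m\<close>.\<close>
  have ev2: "\<forall>\<^sub>F m in sequentially. 1 \<le> \<eta> * (real m + 1)\<^sup>2"
    using \<open>0 < \<eta>\<close> by real_asymp
  show ?thesis
    using conc rem AE_unit AE_crossing_bounds[OF \<kappa>(1)]
  proof eventually_elim
    case (elim \<omega>)
    note \<omega> = \<open>\<forall>x. 0 < \<omega> x \<and> \<omega> x \<le> 1\<close> and bounds = elim(4)
    from elim(1,2) ev1 ev2 show ?case
    proof eventually_elim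
      case (elim m)
      define W where "W = {- I * 2 ^ m..<I * 2 ^ m}"
      define r where "r k = crossing \<kappa> \<omega> (J m) k - crossing \<kappa> \<omega> (j m) k" for k
      have r: "0 \<le> r k" for k
        using crossing_mono[OF \<kappa>(1), of \<omega> "j m" "J m" k] \<omega> by (simp add: r_def J_def)
      have a_le: "a \<omega> m k \<le> crossing \<kappa> \<omega> (j m) k + r k" if "k \<in> W" for k
      proof -
        have "nat (k + I * 2 ^ m + 1) \<le> J m"
          using that by (auto simp: W_def J_def)
        then show ?thesis
          unfolding a r_def using crossing_mono[OF \<kappa>(1), of \<omega> _ "J m" k] \<omega> by simp
      qed
      have rem: "2 * (real m + 1)\<^sup>2 * sum r W < 2 ^ m"
        using elim(2) by (simp add: r_def W_def)
      show ?case
      proof (intro conjI allI impI)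
        fix k assume "- I * 2 ^ m \<le> k" "k < I * 2 ^ m"
        then have k: "k \<in> W" by (simp add: W_def)
        have "r k \<le> sum r W"
          using r k by (intro member_le_sum) (auto simp: W_def)
        moreover have "crossing \<kappa> \<omega> (j m) k \<le> 2 powr (real m / 2)"
          using bounds bound_le[of m] by (meson order_trans)
        ultimately have "a \<omega> m k \<le> 2 powr (real m / 2) + sum r W"
          using a_le[OF k] by linarith
        then have "(real m + 1)\<^sup>2 * a \<omega> m k \<le> (real m + 1)\<^sup>2 * (2 powr (real m / 2) + sum r W)"
          by (intro mult_left_mono) auto
        with rem elim(3) show "(real m + 1)\<^sup>2 * a \<omega> m k \<le> 2 ^ m"
          by (simp add: distrib_left)
      next
        fix i assume i: "- I \<le> i" "i < I"
        let ?B = "{i * 2 ^ m..<(i + 1) * 2 ^ m}"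
        have "- I * 2 ^ m \<le> i * 2 ^ m" "(i + 1) * 2 ^ m \<le> I * 2 ^ m"
          using i by (intro mult_right_mono; simp)+
        then have B: "?B \<subseteq> W" by (auto simp: W_def)
        have "sum (a \<omega> m) ?B \<le> sum (crossing \<kappa> \<omega> (j m)) ?B + sum r ?B"
          unfolding sum.distrib[symmetric] using a_le B by (intro sum_mono) blast
        also have "sum r ?B \<le> sum r W"
          using B r by (intro sum_mono2) (auto simp: W_def)
        also have "sum r W \<le> \<eta> / 2 * 2 ^ m"
        proof -
          have "sum r W \<le> \<eta> * (real m + 1)\<^sup>2 * sum r W"
            using elim(4) r mult_right_mono[of 1 "\<eta> * (real m + 1)\<^sup>2" "sum r W"]
            by (simp add: sum_nonneg)
          also have "\<dots> = \<eta> / 2 * (2 * (real m + 1)\<^sup>2 * sum r W)" by simp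
          also have "\<dots> \<le> \<eta> / 2 * 2 ^ m"
            using rem \<open>0 < \<eta>\<close> by (intro mult_left_mono) auto
          finally show ?thesis .
        qed
        also have "sum (crossing \<kappa> \<omega> (j m)) ?B \<le> mean_crossing \<kappa> * 2 ^ m + \<eta> / 2 * 2 ^ m"
        proof -
          have "0 \<le> mean_crossing \<kappa> * (\<kappa> * \<mu>) ^ j m * 2 ^ m"
            using \<kappa> \<mu>_nonneg mean_crossing_nonneg[OF \<kappa>] by simp
          moreover have "\<bar>sum (crossing \<kappa> \<omega> (j m)) ?B - mean_crossing \<kappa> * (1 - (\<kappa> * \<mu>) ^ j m) * 2 ^ m\<bar> < \<eta> / 2 * 2 ^ m"
            using elim(1) i by blast
          ultimately show ?thesis unfolding abs_less_iff by (simp add: right_diff_distrib left_diff_distrib)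
        qed
        finally show "sum (a \<omega> m) ?B \<le> (mean_crossing \<kappa> + \<eta>) * 2 ^ m"
          by (simp add: algebra_simps)
      qed
    qed
  qed
qed

end


section \<open>The law of large numbers\<close>

text \<open>The exponential of a negative multiple of the squared logarithm is \<open>n\<close> to a
  power tending to minus infinity, so it outweighs the polynomial number of chains.\<close>

lemma summable_superpolynomial:
  fixes C C' :: real and Q W g :: nat
  assumes "0 < C" "0 < C'" "0 < Q"
  shows "summable (\<lambda>n. (2 * real W * real n + 1) *
    (real n ^ g * (exp (- (C * (log 2 (real n / real Q))\<^sup>2)) + exp (- (C' * real n)))))"
proof (rule summable_comparison_test_bigo)
  show "summable (\<lambda>n. norm (inverse (real n ^ 2)))"
    using inverse_power_summable[of 2, where 'a=real] by simp
  define q where "q = real Q"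
  \<comment> \<open>For \<open>W = 0\<close> the leading coefficient \<open>2 * W\<close> vanishes;
    the majorant with \<open>W + 1\<close> has the same asymptotic form for every
    \<open>W\<close>.\<close>
  define w where "w = real W + 1"
  have pos: "0 < q" "0 < w" using assms by (simp_all add: q_def w_def add_nonneg_pos)
  have "(\<lambda>n. (2 * w * real n + 1) *
    (real n ^ g * (exp (- (C * (log 2 (real n / q))\<^sup>2)) + exp (- (C' * real n))))) \<in> O(\<lambda>n. inverse (real n ^ 2))"
    using assms pos by real_asymp
  moreover have "(\<lambda>n. (2 * real W * real n + 1) *
    (real n ^ g * (exp (- (C * (log 2 (real n / q))\<^sup>2)) + exp (- (C' * real n))))) \<in>
    O(\<lambda>n. (2 * w * real n + 1) *
    (real n ^ g * (exp (- (C * (log 2 (real n / q))\<^sup>2)) + exp (- (C' * real n)))))"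
    by (intro landau_o.big_mono always_eventually allI)
      (auto simp: abs_mult w_def intro!: mult_right_mono)
  ultimately show "(\<lambda>n. (2 * real W * real n + 1) *
    (real n ^ g * (exp (- (C * (log 2 (real n / real Q))\<^sup>2)) + exp (- (C' * real n))))) \<in> O(\<lambda>n. inverse (real n ^ 2))"
    unfolding q_def by (rule landau_o.big_trans[rotated])
qed

context iid_environment
begin

section \<open>Choice of parameters and deviation bounds for almost every environment\<close>

lemma speed_eq: "speed P = (1 - \<mu>) / (1 + \<mu>)"
  by (simp add: speed_def \<mu>_def)

lemma speed_pos: "0 < speed P"
  using \<mu>_nonneg \<mu>_less_1 by (simp add: speed_eq)

lemma speed_le_1: "speed P \<le> 1"
  using \<mu>_nonneg by (simp add: speed_eq)

lemma mean_crossing_1: "mean_crossing 1 = 1 / speed P"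
  by (simp add: mean_crossing_def speed_eq)

text \<open>\<open>mean_crossing\<close> is continuous at 1 because \<open>1 - \<mu>\<close> is
  positive. So a factor \<kappa> close to 1 is affordable for every slope different from
  \<open>speed P\<close>.\<close>

lemma tendsto_mean_crossing:
  assumes "(f \<longlongrightarrow> 1) F"
  shows "((\<lambda>t. mean_crossing (f t)) \<longlongrightarrow> 1 / speed P) F"
  unfolding mean_crossing_1[symmetric] mean_crossing_def
  using \<mu>_less_1 by (intro tendsto_intros assms) auto

text \<open>One parameter \<open>t\<close> governs everything: \<open>d = 1 / t\<close>,
  \<open>Q = t\<close>, and block error \<open>1 / t\<close>. As \<open>t\<close> grows,
  \<open>(w + 2 / t) * \<tau> t\<close> tends to \<open>w / speed P\<close>, which is less than 1,
  so some \<open>t\<close> meets all requirements of \<open>slow_deviation\<close>.\<close>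

lemma AE_slow_deviation:
  assumes w: "0 \<le> w" "w < speed P"
  shows "AE \<omega> in P. \<exists>Q>0. \<exists>C>0. \<forall>\<^sub>F n in sequentially. \<forall>x. \<bar>x\<bar> \<le> int W * int n \<longrightarrow>
    measure (walk_pmf \<omega> x n) {z. of_int z \<le> of_int x + w * real n} \<le> exp (- (C * (log 2 (real n / real Q))\<^sup>2))"
proof -
  define \<kappa> where "\<kappa> t = (1 + 1 / real t) / (1 - 1 / real t)" for t :: nat
  define \<tau> where "\<tau> t = mean_crossing (\<kappa> t) + 1 / real t" for t :: nat
  have "\<kappa> \<longlonglongrightarrow> 1" unfolding \<kappa>_def by real_asymp
  have inv: "(\<lambda>t. 1 / real t) \<longlonglongrightarrow> 0" "(\<lambda>t. 2 / real t) \<longlonglongrightarrow> 0" by real_asymp+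
  have "(\<lambda>t. \<kappa> t * \<mu>) \<longlonglongrightarrow> 1 * \<mu>"
    by (intro tendsto_intros \<open>\<kappa> \<longlonglongrightarrow> 1\<close>)
  then have ev1: "\<forall>\<^sub>F t in sequentially. \<kappa> t * \<mu> < 1"
    by (rule order_tendstoD) (simp add: \<mu>_less_1)
  have "(\<lambda>t. (w + 2 / real t) * \<tau> t) \<longlonglongrightarrow> (w + 0) * (1 / speed P + 0)"
    unfolding \<tau>_def by (intro tendsto_intros inv tendsto_mean_crossing \<open>\<kappa> \<longlonglongrightarrow> 1\<close>)
  then have ev2: "\<forall>\<^sub>F t in sequentially. (w + 2 / real t) * \<tau> t < 1"
    by (rule order_tendstoD) (use w speed_pos in simp)
  have "\<forall>\<^sub>F t in sequentially. \<kappa> t * \<mu> < 1 \<and> (w + 2 / real t) * \<tau> t < 1 \<and> 1 < t"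
    using ev1 ev2 eventually_gt_at_top[of "1::nat"] by eventually_elim auto
  then obtain t where t: "\<kappa> t * \<mu> < 1" "(w + 2 / real t) * \<tau> t < 1" "1 < t"
    by (rule eventually_happens'[OF sequentially_bot, THEN exE]) auto
  then have "0 \<le> \<kappa> t" by (simp add: \<kappa>_def)
  define I where "I = 2 * int t * (int W + 2)"
  define a where "a \<omega> m k = crossing (\<kappa> t) \<omega> (nat (k + I * 2 ^ m + 1)) k" for \<omega> m k
  have "AE \<omega> in P. \<forall>\<^sub>F m in sequentially.
      (\<forall>i. - I \<le> i \<longrightarrow> i < I \<longrightarrow> sum (a \<omega> m) {i * 2 ^ m..<(i + 1) * 2 ^ m} \<le> \<tau> t * 2 ^ m) \<and>
      (\<forall>k. - I * 2 ^ m \<le> k \<longrightarrow> k < I * 2 ^ m \<longrightarrow> (real m + 1)\<^sup>2 * a \<omega> m k \<le> 2 ^ m)"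
    unfolding \<tau>_def
    by (rule AE_slow_blocks) (use t \<open>0 \<le> \<kappa> t\<close> in \<open>auto simp: I_def a_def\<close>)
  then show ?thesis
    using AE_elliptic
  proof eventually_elim
    case (elim \<omega>)
    have "\<exists>C>0. \<forall>\<^sub>F n in sequentially. \<forall>x. \<bar>x\<bar> \<le> int W * int n \<longrightarrow>
      measure (walk_pmf \<omega> x n) {z. of_int z \<le> of_int x + w * real n} \<le> exp (- (C * (log 2 (real n / real t))\<^sup>2))"
      by (rule slow_deviation[OF c_pos, where d="1 / real t" and \<kappa>="\<kappa> t" and I=I and a="a \<omega>" and \<tau>="\<tau> t"])
        (use elim t w speed_le_1 mean_crossing_nonneg[OF \<open>0 \<le> \<kappa> t\<close> t(1)]
         in \<open>auto simp: \<kappa>_def I_def a_def \<tau>_def intro!: add_nonneg_nonneg\<close>)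
    then show ?case using t by (intro exI[of _ t]) auto
  qed
qed

text \<open>Here \<open>t\<close> is also the truncation level, and
  \<open>(w - 2 / t) * \<tau> t\<close> tends to \<open>w / speed P\<close>, which exceeds
  1.\<close>

lemma AE_fast_deviation:
  assumes w: "speed P < w" "w \<le> 2"
  shows "AE \<omega> in P. \<exists>C>0. \<forall>\<^sub>F n in sequentially. \<forall>x. \<bar>x\<bar> \<le> int W * int n \<longrightarrow>
    measure (walk_pmf \<omega> x n) {z. of_int x + w * real n \<le> of_int z} \<le> exp (- (C * real n))"
proof -
  define \<kappa> where "\<kappa> t = (1 - 1 / real t) / (1 + 1 / real t)" for t :: nat
  \<comment> \<open>Writing \<open>\<mu> ^ t\<close> in place of
    \<open>(\<kappa> t * \<mu>) ^ t\<close> makes the base independent of \<open>t\<close>. Since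
    \<open>\<kappa> t \<le> 1\<close> for the chosen \<open>t\<close>, this only lowers
    \<open>\<tau> t\<close>, so it is still a lower bound for the block averages.\<close>
  define \<tau> where "\<tau> t = mean_crossing (\<kappa> t) * (1 - \<mu> ^ t) - 1 / real t" for t :: nat
  have "\<kappa> \<longlonglongrightarrow> 1" unfolding \<kappa>_def by real_asymp
  have inv: "(\<lambda>t. 1 / real t) \<longlonglongrightarrow> 0" "(\<lambda>t. 2 / real t) \<longlonglongrightarrow> 0" by real_asymp+
  have "(\<lambda>t. \<mu> ^ t) \<longlonglongrightarrow> 0"
    by (rule LIMSEQ_realpow_zero[OF \<mu>_nonneg \<mu>_less_1])
  then have "\<tau> \<longlonglongrightarrow> 1 / speed P * (1 - 0) - 0"
    unfolding \<tau>_def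
    by (intro tendsto_intros inv tendsto_mean_crossing \<open>\<kappa> \<longlonglongrightarrow> 1\<close>) (use \<mu>_nonneg \<mu>_less_1 in auto)
  then have \<tau>_lim: "\<tau> \<longlonglongrightarrow> 1 / speed P" by simp
  then have ev1: "\<forall>\<^sub>F t in sequentially. 0 < \<tau> t"
    by (rule order_tendstoD) (simp add: speed_pos)
  have "(\<lambda>t. (w - 2 / real t) * \<tau> t) \<longlonglongrightarrow> (w - 0) * (1 / speed P)"
    by (intro tendsto_intros inv \<tau>_lim)
  then have ev2: "\<forall>\<^sub>F t in sequentially. 1 < (w - 2 / real t) * \<tau> t"
    by (rule order_tendstoD) (use w speed_pos in simp)
  have "\<forall>\<^sub>F t in sequentially. 0 < \<tau> t \<and> 1 < (w - 2 / real t) * \<tau> t \<and> 1 < t"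
    using ev1 ev2 eventually_gt_at_top[of "1::nat"] by eventually_elim auto
  then obtain t where t: "0 < \<tau> t" "1 < (w - 2 / real t) * \<tau> t" "1 < t"
    by (rule eventually_happens'[OF sequentially_bot, THEN exE]) auto
  have "0 < 1 + 1 / real t" by (simp add: add_pos_nonneg)
  then have \<kappa>: "0 \<le> \<kappa> t" "\<kappa> t \<le> 1"
    using t by (simp_all add: \<kappa>_def pos_divide_le_eq)
  then have \<kappa>\<mu>: "\<kappa> t * \<mu> \<le> \<mu>" using \<mu>_nonneg by (simp add: mult_left_le_one_le)
  then have "\<kappa> t * \<mu> < 1" using \<mu>_less_1 by linarith
  define I where "I = 2 * int t * (int W + 2)"
  have \<tau>_le: "\<tau> t \<le> mean_crossing (\<kappa> t) * (1 - (\<kappa> t * \<mu>) ^ t) - 1 / real t"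
    unfolding \<tau>_def using \<kappa> \<kappa>\<mu> \<mu>_nonneg mean_crossing_nonneg[OF \<kappa>(1) \<open>\<kappa> t * \<mu> < 1\<close>]
    by (intro diff_right_mono mult_left_mono diff_left_mono power_mono) auto
  have "AE \<omega> in P. \<forall>\<^sub>F m in sequentially. \<forall>i. - I \<le> i \<longrightarrow> i < I \<longrightarrow>
    (mean_crossing (\<kappa> t) * (1 - (\<kappa> t * \<mu>) ^ t) - 1 / real t) * 2 ^ m \<le>
      sum (crossing (\<kappa> t) \<omega> t) {i * 2 ^ m..<(i + 1) * 2 ^ m}"
    by (rule AE_fast_blocks) (use \<kappa> \<open>\<kappa> t * \<mu> < 1\<close> t in auto)
  then show ?thesis
    using AE_elliptic
  proof eventually_elim
    case (elim \<omega>)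
    have good: "\<forall>\<^sub>F m in sequentially. \<forall>i. - I \<le> i \<longrightarrow> i < I \<longrightarrow>
      \<tau> t * 2 ^ m \<le> sum (crossing (\<kappa> t) \<omega> t) {i * 2 ^ m..<(i + 1) * 2 ^ m}"
      using elim(1)
    proof eventually_elim
      case (elim m)
      have "\<tau> t * 2 ^ m \<le> (mean_crossing (\<kappa> t) * (1 - (\<kappa> t * \<mu>) ^ t) - 1 / real t) * 2 ^ m"
        by (intro mult_right_mono \<tau>_le) auto
      with elim show ?case by (meson order_trans)
    qed
    show ?case
      by (rule fast_deviation[OF c_pos _ _ _ _ _ _ good, where d="1 / real t" and Q=t])
        (use elim t w speed_pos in \<open>auto simp: \<kappa>_def I_def\<close>)
  qed
qed

text \<open>A larger deviation means a slope of at most \<open>speed P - \<epsilon>\<close> or at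
  least \<open>speed P + \<epsilon>\<close>. The first is nonnegative as
  \<open>\<epsilon> < speed P\<close>, and the second is at most 2 as
  \<open>speed P \<le> 1\<close>.\<close>

lemma AE_quenched_deviation:
  assumes "0 < \<epsilon>" "\<epsilon> < speed P"
  shows "AE \<omega> in P. AE X in quenched \<omega>. \<forall>\<^sub>F n in sequentially. \<forall>x i. \<bar>x\<bar> \<le> int W * int n \<longrightarrow>
    1 \<le> i \<longrightarrow> i \<le> n ^ g \<longrightarrow> \<bar>real_of_int (X (x, i) n - x) - speed P * real n\<bar> \<le> \<epsilon> * real n"
proof -
  let ?v = "speed P"
  have "AE \<omega> in P. \<exists>Q>0. \<exists>C>0. \<forall>\<^sub>F n in sequentially. \<forall>x. \<bar>x\<bar> \<le> int W * int n \<longrightarrow>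
    measure (walk_pmf \<omega> x n) {z. of_int z \<le> of_int x + (?v - \<epsilon>) * real n} \<le> exp (- (C * (log 2 (real n / real Q))\<^sup>2))"
    by (rule AE_slow_deviation) (use assms in auto)
  moreover have "AE \<omega> in P. \<exists>C>0. \<forall>\<^sub>F n in sequentially. \<forall>x. \<bar>x\<bar> \<le> int W * int n \<longrightarrow>
    measure (walk_pmf \<omega> x n) {z. of_int x + (?v + \<epsilon>) * real n \<le> of_int z} \<le> exp (- (C * real n))"
    by (rule AE_fast_deviation) (use assms speed_le_1 in auto)
  ultimately show ?thesis
  proof eventually_elim
    case (elim \<omega>)
    then obtain Q C C' where QC: "0 < Q" "0 < C" "0 < C'"
      and slow: "\<forall>\<^sub>F n in sequentially. \<forall>x. \<bar>x\<bar> \<le> int W * int n \<longrightarrow>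
        measure (walk_pmf \<omega> x n) {z. of_int z \<le> of_int x + (?v - \<epsilon>) * real n} \<le> exp (- (C * (log 2 (real n / real Q))\<^sup>2))"
      and fast: "\<forall>\<^sub>F n in sequentially. \<forall>x. \<bar>x\<bar> \<le> int W * int n \<longrightarrow>
        measure (walk_pmf \<omega> x n) {z. of_int x + (?v + \<epsilon>) * real n \<le> of_int z} \<le> exp (- (C' * real n))"
      by blast
    show ?case
    proof (rule quenched_eventually_le[OF _ summable_superpolynomial[OF QC(2,3,1)],
          where D="\<lambda>x n z. \<bar>real_of_int (z - x) - speed P * real n\<bar> \<le> \<epsilon> * real n"])
      show "\<forall>\<^sub>F n in sequentially. \<forall>x. \<bar>x\<bar> \<le> int W * int n \<longrightarrow>
        measure (walk_pmf \<omega> x n) {z. \<not> \<bar>real_of_int (z - x) - speed P * real n\<bar> \<le> \<epsilon> * real n} \<le>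
          exp (- (C * (log 2 (real n / real Q))\<^sup>2)) + exp (- (C' * real n))"
        using slow fast
      proof eventually_elim
        case (elim n)
        show ?case
        proof (intro allI impI)
          fix x :: int assume x: "\<bar>x\<bar> \<le> int W * int n"
          let ?S = "{z. of_int z \<le> of_int x + (?v - \<epsilon>) * real n}"
          let ?F = "{z. of_int x + (?v + \<epsilon>) * real n \<le> of_int z}"
          have "{z. \<not> \<bar>real_of_int (z - x) - speed P * real n\<bar> \<le> \<epsilon> * real n} \<subseteq> ?S \<union> ?F"
            by (auto simp: algebra_simps abs_le_iff)
          then have "measure (walk_pmf \<omega> x n) {z. \<not> \<bar>real_of_int (z - x) - speed P * real n\<bar> \<le> \<epsilon> * real n} \<le>
              measure (walk_pmf \<omega> x n) (?S \<union> ?F)"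
            by (intro measure_pmf.finite_measure_mono) auto
          also have "\<dots> \<le> measure (walk_pmf \<omega> x n) ?S + measure (walk_pmf \<omega> x n) ?F"
            by (rule measure_Un_le) auto
          also have "\<dots> \<le> exp (- (C * (log 2 (real n / real Q))\<^sup>2)) + exp (- (C' * real n))"
            using elim x by (intro add_mono) auto
          finally show "measure (walk_pmf \<omega> x n) {z. \<not> \<bar>real_of_int (z - x) - speed P * real n\<bar> \<le> \<epsilon> * real n} \<le>
            exp (- (C * (log 2 (real n / real Q))\<^sup>2)) + exp (- (C' * real n))" .
        qed
      qed
    qed
  qed
qed

text \<open>Integrates the quenched statement over the environment. Passing an almost sure event
  through the bind requires its measurability on the product space.\<close>

lemma AE_averaged_deviation:
  assumes "0 < \<epsilon>" "\<epsilon> < speed P"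
  shows "AE X in averaged P. \<forall>\<^sub>F n in sequentially. \<forall>x i. \<bar>x\<bar> \<le> int W * int n \<longrightarrow>
    i \<le> n ^ g \<longrightarrow> 1 \<le> i \<longrightarrow> \<bar>real_of_int (X (x, i) n - x) - speed P * real n\<bar> \<le> \<epsilon> * real n"
proof -
  let ?B = "PiM (UNIV \<times> {1..}) (\<lambda>_. trajectories) :: (int \<times> nat \<Rightarrow> nat \<Rightarrow> int) measure"
  \<comment> \<open>With \<open>1 \<le> i\<close> inside \<open>D\<close>, label 0, which is not a
    coordinate of the product, gives a trivially true predicate. Hence \<open>D\<close> is
    measurable for every label, and the event is a countable combination of such predicates.\<close>
  define D where "D x i n X \<longleftrightarrow>
      (1 \<le> i \<longrightarrow> \<bar>real_of_int (X (x, i) n - x) - speed P * real n\<bar> \<le> \<epsilon> * real n)"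
    for x and i n :: nat and X :: "int \<times> nat \<Rightarrow> nat \<Rightarrow> int"
  have [measurable]: "Measurable.pred ?B (D x i n)" for x i n
  proof (cases "1 \<le> i")
    case True
    then have "(\<lambda>X. X (x, i)) \<in> ?B \<rightarrow>\<^sub>M trajectories"
      by (intro measurable_component_singleton) auto
    then have "(\<lambda>X. X (x, i) n) \<in> ?B \<rightarrow>\<^sub>M count_space UNIV"
      by (rule measurable_compose) (rule measurable_component_singleton, simp)
    then have "Measurable.pred ?B (\<lambda>X. \<bar>real_of_int (X (x, i) n - x) - speed P * real n\<bar> \<le> \<epsilon> * real n)"
      by (rule measurable_compose) simp
    then show ?thesis by (simp add: D_def[abs_def])
  qed (simp add: D_def[abs_def])
  have "quenched \<in> P \<rightarrow>\<^sub>M subprob_algebra ?B"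
    using measurable_prob_algebraD[OF measurable_quenched] sets_P by (simp cong: measurable_cong_sets)
  moreover have "Measurable.pred ?B (\<lambda>X. \<forall>\<^sub>F n in sequentially. \<forall>x i. \<bar>x\<bar> \<le> int W * int n \<longrightarrow>
    i \<le> n ^ g \<longrightarrow> D x i n X)"
    unfolding eventually_sequentially by measurable
  ultimately show ?thesis
    unfolding averaged_def D_def
  proof (subst AE_bind)
    show "AE \<omega> in P. AE X in quenched \<omega>. \<forall>\<^sub>F n in sequentially. \<forall>x i. \<bar>x\<bar> \<le> int W * int n \<longrightarrow>
      i \<le> n ^ g \<longrightarrow> 1 \<le> i \<longrightarrow> \<bar>real_of_int (X (x, i) n - x) - speed P * real n\<bar> \<le> \<epsilon> * real n"
      using AE_quenched_deviation[OF assms, of W g]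
    proof eventually_elim
      case (elim \<omega>)
      then show ?case by eventually_elim (auto elim: eventually_mono)
    qed
  qed
qed

end

section \<open>From uniform deviation bounds to the limit of the maximum\<close>

lemma max_deviation_le:
  assumes "finite Y" "finite J" "0 \<le> \<epsilon>" "0 < n"
    and "\<And>y i. y \<in> Y \<Longrightarrow> i \<in> J \<Longrightarrow> \<bar>real_of_int (X (y, i) n - y) - v * real n\<bar> \<le> \<epsilon> * real n"
  shows "\<bar>max_deviation v Y J X n\<bar> \<le> \<epsilon>"
proof -
  let ?S = "insert 0 ((\<lambda>(y, i). \<bar>real_of_int (X (y, i) n - y) / real n - v\<bar>) ` (Y \<times> J))"
  have "finite ?S" using assms by auto
  have "Max ?S \<le> \<epsilon>"
  proof (rule Max.boundedI[OF \<open>finite ?S\<close>])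
    fix s assume "s \<in> ?S"
    then consider "s = 0" | y i where "y \<in> Y" "i \<in> J" "s = \<bar>real_of_int (X (y, i) n - y) / real n - v\<bar>"
      by auto
    then show "s \<le> \<epsilon>"
    proof cases
      case 2
      have "real_of_int (X (y, i) n - y) / real n - v = (real_of_int (X (y, i) n - y) - v * real n) / real n"
        using \<open>0 < n\<close> by (simp add: diff_divide_distrib)
      then have "s = \<bar>real_of_int (X (y, i) n - y) - v * real n\<bar> / real n"
        unfolding 2(3) by (simp only: abs_divide abs_of_nat)
      then show ?thesis
        using assms(5)[OF 2(1,2)] \<open>0 < n\<close> by (simp add: pos_divide_le_eq)
    qed (use assms in simp)
  qed simp
  moreover have "0 \<le> Max ?S" using \<open>finite ?S\<close> by (intro Max_ge) auto
  ultimately show ?thesis by (simp add: max_deviation_def)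
qed

theorem theorem1p1:
  fixes P :: "(int \<Rightarrow> real) measure" and c A B \<gamma> :: real
  assumes "prob_space P" and "sets P = sets environments"
    and "prob_space.indep_vars P (\<lambda>_. borel) (\<lambda>x \<omega>. \<omega> x) (UNIV :: int set)"
    and "\<And>x. distr P borel (\<lambda>\<omega>. \<omega> x) = distr P borel (\<lambda>\<omega>. \<omega> 0)"
    and "c > 0" and "measure P {\<omega> \<in> space P. \<omega> 0 \<in> {c..1 - c}} = 1"
    and "(\<integral>\<omega>. rho \<omega> 0 \<partial>P) < 1"
    and "A < B"
  shows "AE X in averaged P.
    (\<lambda>n. max_deviation (speed P) {y. A * real n < of_int y \<and> of_int y \<le> B * real n}
           {i. 1 \<le> i \<and> real i \<le> real n powr \<gamma>} X n) \<longlonglongrightarrow> 0"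
proof -
  interpret iid_environment P c
    using assms(1-7) by (intro iid_environment.intro iid_environment_axioms.intro)
  define W where "W = nat \<lceil>max \<bar>A\<bar> \<bar>B\<bar>\<rceil>"
  \<comment> \<open>For negative \<gamma> this is 0, in accordance with
    \<open>real n powr \<gamma> \<le> 1\<close> for \<open>n \<ge> 1\<close>.\<close>
  define g where "g = nat \<lceil>\<gamma>\<rceil>"
  \<comment> \<open>Countably many tolerances suffice, so the exceptional null sets can be united.
    The 2 in the denominator keeps even \<open>\<epsilon> 0\<close> strictly below
    \<open>speed P\<close>.\<close>
  define \<epsilon> where "\<epsilon> k = speed P / (real k + 2)" for k
  have \<epsilon>: "0 < \<epsilon> k" "\<epsilon> k < speed P" for k
    using speed_pos by (auto simp: \<epsilon>_def field_simps intro!: add_pos_nonneg)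
  have "\<epsilon> \<longlonglongrightarrow> 0" unfolding \<epsilon>_def by real_asymp
  let ?Y = "\<lambda>n. {y. A * real n < of_int y \<and> of_int y \<le> B * real n}"
  let ?J = "\<lambda>n. {i. 1 \<le> i \<and> real i \<le> real n powr \<gamma>}"
  have W: "\<bar>A\<bar> \<le> real W" "\<bar>B\<bar> \<le> real W" unfolding W_def by linarith+
  have Y: "\<bar>y\<bar> \<le> int W * int n" if "y \<in> ?Y n" for y n
  proof -
    have "\<bar>A\<bar> * real n \<le> real W * real n" "\<bar>B\<bar> * real n \<le> real W * real n"
      using W by (intro mult_right_mono; simp)+
    moreover have "(- \<bar>A\<bar>) * real n \<le> A * real n" "B * real n \<le> \<bar>B\<bar> * real n"
      by (intro mult_right_mono; simp)+
    ultimately have "\<bar>real_of_int y\<bar> \<le> real W * real n" using that by auto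
    then have "real_of_int \<bar>y\<bar> \<le> real_of_int (int W * int n)" by simp
    then show ?thesis by (simp only: of_int_le_iff)
  qed
  have J: "i \<le> n ^ g" if "i \<in> ?J n" "1 \<le> n" for i n
  proof -
    have "real i \<le> real n powr \<gamma>" using that by simp
    also have "\<dots> \<le> real n powr real g"
      using that unfolding g_def by (intro powr_mono) linarith+
    also have "\<dots> = real (n ^ g)" using that by (simp add: powr_realpow)
    finally show ?thesis by (simp only: of_nat_le_iff)
  qed
  have fin_Y: "finite (?Y n)" for n
  proof (rule finite_subset)
    show "?Y n \<subseteq> {- (int W * int n)..int W * int n}"
    proof
      fix y assume "y \<in> ?Y n"
      from Y[OF this] show "y \<in> {- (int W * int n)..int W * int n}" by auto
    qed
  qed simp
  have fin_J: "finite (?J n)" if "1 \<le> n" for n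
    by (rule finite_subset[of _ "{..n ^ g}"]) (use J[OF _ that] in auto)
  have "AE X in averaged P. \<forall>k. \<forall>\<^sub>F n in sequentially. \<forall>x i. \<bar>x\<bar> \<le> int W * int n \<longrightarrow>
    i \<le> n ^ g \<longrightarrow> 1 \<le> i \<longrightarrow> \<bar>real_of_int (X (x, i) n - x) - speed P * real n\<bar> \<le> \<epsilon> k * real n"
    unfolding AE_all_countable using AE_averaged_deviation[OF \<epsilon>] by blast
  then show ?thesis
  proof eventually_elim
    case (elim X)
    show ?case
    proof (rule LIMSEQ_I)
      fix r :: real assume "0 < r"
      then have "\<forall>\<^sub>F k in sequentially. \<epsilon> k < r" using order_tendstoD(2)[OF \<open>\<epsilon> \<longlonglongrightarrow> 0\<close>] by blast
      then obtain k where "\<epsilon> k < r" by (auto simp: eventually_sequentially)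
      from elim have "\<forall>\<^sub>F n in sequentially. \<forall>x i. \<bar>x\<bar> \<le> int W * int n \<longrightarrow>
        i \<le> n ^ g \<longrightarrow> 1 \<le> i \<longrightarrow> \<bar>real_of_int (X (x, i) n - x) - speed P * real n\<bar> \<le> \<epsilon> k * real n"
        by blast
      then have "\<forall>\<^sub>F n in sequentially. norm (max_deviation (speed P) (?Y n) (?J n) X n - 0) < r"
        using eventually_ge_at_top[of "1::nat"]
      proof eventually_elim
        case (elim n)
        have "\<bar>max_deviation (speed P) (?Y n) (?J n) X n\<bar> \<le> \<epsilon> k"
          by (rule max_deviation_le) (use elim fin_Y fin_J \<epsilon>[of k] Y J in \<open>auto simp: less_imp_le\<close>)
        with \<open>\<epsilon> k < r\<close> show ?case by simp
      qed
      then show "\<exists>N. \<forall>n\<ge>N. norm (max_deviation (speed P) (?Y n) (?J n) X n - 0) < r"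
        by (simp add: eventually_sequentially)
    qed
  qed
qed

end
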